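(* There exists a constant $C>0$ such that for $p\ge C n^{-1/2}$, the Glauber dynamics for sampling from $\mu_{\mathcal{T},p}$ has mixing time $\Omega(e^{\sqrt n})$.
   Context: All graphs are on the vertex set $[n]$ and are identified with their edge sets. Let $\mathcal{T}$ be the set of triangle-free graphs on $[n]$, $\mu_p$ the law of $G(n,p)$, and $\mu_{\mathcal{T},p}$ the law of $G(n,p)$ conditioned on being triangle-free. The Glauber dynamics for $\mu_{\mathcal{T},p}$ is the Markov chain on $\mathcal{T}$ which at each step chooses a pair $e\in\binom{[n]}{2}$ uniformly at random and resamples its status from its conditional law given all other pairs: $e$ is included with probability $p$ if adding $e$ creates no triangle (and with probability $0$ if it would create a triangle), and removed otherwise. The mixing time is $\max_{X_0}\min\{t:\|\mu_t^{X_0}-\mu_{\mathcal{T},p}\|_{TV}<1/4\}$, with $\mu_t^{X_0}$ the law after $t$ steps from $X_0$. *)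

theory Defs
  imports "HOL-Probability.Probability" "HOL-Library.Ramsey" "HOL-Library.Extended_Nat"
begin

text \<open>Graphs on \<open>{1..n}\<close> are identified with their edge sets, i.e. subsets of \<open>nsets {1..n} 2\<close>.\<close>

definition triangle_free :: "'a set set \<Rightarrow> bool" where
  "triangle_free G \<longleftrightarrow>
     \<not> (\<exists>x y z. x \<noteq> y \<and> y \<noteq> z \<and> x \<noteq> z \<and> {x, y} \<in> G \<and> {y, z} \<in> G \<and> {x, z} \<in> G)"

definition triangle_free_graphs :: "nat \<Rightarrow> nat set set set" where
  "triangle_free_graphs n = {G. G \<subseteq> nsets {1..n} 2 \<and> triangle_free G}"

definition gnp :: "nat \<Rightarrow> real \<Rightarrow> nat set set pmf" where
  "gnp n p = map_pmf (\<lambda>f. {e \<in> nsets {1..n} 2. f e})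
     (Pi_pmf (nsets {1..n} 2) False (\<lambda>_. bernoulli_pmf p))"

text \<open>
  The conditioning is meaningful for \<open>p < 1\<close>, where the empty graph has positive probability.
  For \<open>p = 1\<close> and \<open>n \<ge> 3\<close> the conditioning event is null and \<open>cond_pmf\<close> is unspecified.
\<close>
definition gnp_triangle_free :: "nat \<Rightarrow> real \<Rightarrow> nat set set pmf" where
  "gnp_triangle_free n p = cond_pmf (gnp n p) (triangle_free_graphs n)"

text \<open>
  The transition kernel is meaningful for \<open>n \<ge> 2\<close>, when there is a pair to choose.
\<close>
definition glauber_step :: "nat \<Rightarrow> real \<Rightarrow> nat set set \<Rightarrow> nat set set pmf" where
  "glauber_step n p G =
     bind_pmf (pmf_of_set (nsets {1..n} 2)) (\<lambda>e.
       if triangle_free (insert e G)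
       then map_pmf (\<lambda>b. if b then insert e G else G - {e}) (bernoulli_pmf p)
       else return_pmf (G - {e}))"

definition glauber_law :: "nat \<Rightarrow> real \<Rightarrow> nat set set \<Rightarrow> nat \<Rightarrow> nat set set pmf" where
  "glauber_law n p X0 t = ((\<lambda>\<nu>. bind_pmf \<nu> (glauber_step n p)) ^^ t) (return_pmf X0)"

definition tv_dist :: "'a pmf \<Rightarrow> 'a pmf \<Rightarrow> real" where
  "tv_dist P Q = (SUP A. \<bar>measure_pmf.prob P A - measure_pmf.prob Q A\<bar>)"

text \<open>
  The infimum is the minimum whenever the set of times is nonempty, and \<open>\<infinity>\<close> otherwise. The
  supremum ranges over the finite nonempty set of starting states, so it is a maximum.
\<close>
definition glauber_mixing_time :: "nat \<Rightarrow> real \<Rightarrow> enat" where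
  "glauber_mixing_time n p =
     (SUP X0 \<in> triangle_free_graphs n.
        INF t \<in> {t. tv_dist (glauber_law n p X0 t) (gnp_triangle_free n p) < 1 / 4}. enat t)"

end

theory Submission
  imports Defs
begin

text \<open>
  Fix a balanced bipartition \<open>A\<close>, \<open>B\<close> and let \<open>S\<close> be the set of triangle-free graphs in which every
  vertex has at most \<open>d\<close> neighbours on its own side, with \<open>d\<close> of order \<open>1 / p\<close>. The chain leaves
  \<open>S\<close> only through graphs in which some \<open>v \<in> A\<close> (say) has exactly \<open>d\<close> neighbours \<open>U \<subseteq> A\<close>. Then \<open>v\<close>
  has no neighbour in common with \<open>U\<close>, whereas otherwise there are about \<open>p\<^sup>2 d n\<close> paths of length two
  from \<open>v\<close> to \<open>U\<close> through \<open>B\<close>: a switching argument bounds the relative weight of such graphs by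
  \<open>exp (- c p\<^sup>2 d n)\<close>, which for \<open>p \<ge> C / sqrt n\<close> with \<open>C\<close> large beats the entropy
  \<open>(n choose d) p\<^sup>d\<close> of the choice of \<open>U\<close>. So the exit probability of the stationary chain conditioned
  on \<open>S\<close> is at most \<open>exp (- sqrt n)\<close> per step. No global structure of triangle-free graphs is needed:
  moving one vertex to the other side gives a second such set which almost avoids \<open>S\<close>, so one of
  the two has stationary probability at most \<open>5 / 8\<close>. For \<open>p\<close> bounded below the same scheme works with
  the graphs having at most one edge inside \<open>A\<close> or \<open>B\<close>.
\<close>

section \<open>Bottlenecks of stationary chains\<close>

text \<open>Two constraints fix the scale of \<open>d\<close>. Switchings need room: with degrees up
  to \<open>k\<close> of order \<open>p * n\<close>, about \<open>d * k\<close> vertices become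
  unusable, and this must stay a small fraction of \<open>n\<close>; hence \<open>d\<close> is at
  most a small multiple of \<open>1 / p\<close>. Conversely the gain exponent
  \<open>p\<^sup>2 * d * n\<close> must reach \<open>sqrt n\<close>; for \<open>d\<close> of order
  \<open>1 / p\<close> it has order \<open>p * n\<close>, a large multiple of \<open>sqrt n\<close>
  as soon as \<open>p * sqrt n\<close> is large. The entropy is then about
  \<open>d * ln (p\<^sup>2 * n)\<close>, which \<open>d * p\<^sup>2 * n\<close> beats once
  \<open>p\<^sup>2 * n\<close> exceeds a constant, so no logarithm is lost at the threshold. When
  \<open>p\<close> is of constant order, a small multiple of \<open>1 / p\<close> may fall below 1
  and leave no positive integer for \<open>d\<close>; this is what forces a separate scheme
  there.\<close>

lemma funpow_bind_pmf:
  fixes K :: "'a \<Rightarrow> 'a pmf"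
  shows "((\<lambda>\<nu>. bind_pmf \<nu> K) ^^ t) \<nu> = bind_pmf \<nu> (\<lambda>x. ((\<lambda>\<nu>. bind_pmf \<nu> K) ^^ t) (return_pmf x))"
proof (induction t)
  case 0
  then show ?case by (simp add: bind_return_pmf')
next
  case (Suc t)
  have "((\<lambda>\<nu>. bind_pmf \<nu> K) ^^ Suc t) \<nu>
      = bind_pmf (bind_pmf \<nu> (\<lambda>x. ((\<lambda>\<nu>. bind_pmf \<nu> K) ^^ t) (return_pmf x))) K"
    using Suc by simp
  then show ?case by (simp add: bind_assoc_pmf)
qed

text \<open>The iterated law appends steps at the end, while exit probabilities condition on the
  first step; this passes from one form to the other.\<close>

lemma funpow_bind_return_pmf_Suc:
  fixes K :: "'a \<Rightarrow> 'a pmf"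
  shows "((\<lambda>\<nu>. bind_pmf \<nu> K) ^^ Suc t) (return_pmf x)
    = bind_pmf (K x) (\<lambda>y. ((\<lambda>\<nu>. bind_pmf \<nu> K) ^^ t) (return_pmf y))"
  by (subst funpow_bind_pmf [symmetric]) (simp only: funpow_Suc_right o_apply bind_return_pmf)

text \<open>The probability of having left \<open>S\<close> at some time up to \<open>t\<close>, as
  a first-step recursion in which the complement of \<open>S\<close> absorbs. Unlike the probability
  of being outside at time \<open>t\<close>, it is monotone in \<open>t\<close>, so that one
  starting state can serve all times at once.\<close>

primrec exit_prob :: "'a set \<Rightarrow> 'a set \<Rightarrow> ('a \<Rightarrow> 'a pmf) \<Rightarrow> nat \<Rightarrow> 'a \<Rightarrow> real" where
  "exit_prob \<Omega> S K 0 x = (if x \<in> S then 0 else 1)"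
| "exit_prob \<Omega> S K (Suc t) x
    = (if x \<in> S then (\<Sum>y\<in>\<Omega>. pmf (K x) y * exit_prob \<Omega> S K t y) else 1)"

lemma exit_prob_notin: "x \<notin> S \<Longrightarrow> exit_prob \<Omega> S K t x = 1"
  by (cases t) auto

context
  fixes \<Omega> S :: "'a set" and K :: "'a \<Rightarrow> 'a pmf"
  assumes fin: "finite \<Omega>" and S: "S \<subseteq> \<Omega>"
    and K: "\<And>x. x \<in> \<Omega> \<Longrightarrow> set_pmf (K x) \<subseteq> \<Omega>"
begin

lemma sum_pmf_kernel: "x \<in> \<Omega> \<Longrightarrow> (\<Sum>y\<in>\<Omega>. pmf (K x) y) = 1"
  using K fin by (intro sum_pmf_eq_1) auto

lemma exit_prob_bounds: "x \<in> \<Omega> \<Longrightarrow> 0 \<le> exit_prob \<Omega> S K t x \<and> exit_prob \<Omega> S K t x \<le> 1"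
proof (induction t arbitrary: x)
  case (Suc t)
  have "(\<Sum>y\<in>\<Omega>. pmf (K x) y * exit_prob \<Omega> S K t y) \<le> (\<Sum>y\<in>\<Omega>. pmf (K x) y)"
    using Suc.IH by (intro sum_mono mult_left_le) auto
  then show ?case
    using Suc sum_pmf_kernel by (auto intro!: sum_nonneg)
qed auto

lemma exit_prob_step_mono: "x \<in> \<Omega> \<Longrightarrow> exit_prob \<Omega> S K t x \<le> exit_prob \<Omega> S K (Suc t) x"
proof (induction t arbitrary: x)
  case 0
  then show ?case using exit_prob_bounds[of _ 0] by (auto intro!: sum_nonneg)
next
  case (Suc t)
  then show ?case
    by (auto simp del: exit_prob.simps(2) simp: exit_prob.simps(2)[of _ _ _ "Suc t"] exit_prob.simps(2)[of _ _ _ t]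
        intro!: sum_mono mult_left_mono)
qed

lemma exit_prob_mono: "s \<le> t \<Longrightarrow> x \<in> \<Omega> \<Longrightarrow> exit_prob \<Omega> S K s x \<le> exit_prob \<Omega> S K t x"
  by (rule lift_Suc_mono_le[where f = "\<lambda>t. exit_prob \<Omega> S K t x"]) (use exit_prob_step_mono in auto)

lemma prob_outside_le_exit_prob:
  "x \<in> \<Omega> \<Longrightarrow> measure_pmf.prob (((\<lambda>\<nu>. bind_pmf \<nu> K) ^^ t) (return_pmf x)) (- S) \<le> exit_prob \<Omega> S K t x"
proof (induction t arbitrary: x)
  case 0
  then show ?case by (auto simp: measure_return_pmf indicator_def)
next
  case (Suc t)
  let ?L = "\<lambda>t x. ((\<lambda>\<nu>. bind_pmf \<nu> K) ^^ t) (return_pmf x)"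
  show ?case
  proof (cases "x \<in> S")
    case True
    have "measure_pmf.prob (?L (Suc t) x) (- S)
        = measure_pmf.expectation (K x) (\<lambda>y. measure_pmf.prob (?L t y) (- S))"
      unfolding funpow_bind_return_pmf_Suc measure_pmf_bind
      by (rule measure_pmf.measure_bind[where N = "count_space UNIV"])
        (auto simp: space_subprob_algebra intro!: measure_pmf.subprob_space_axioms)
    also have "\<dots> = (\<Sum>y\<in>\<Omega>. pmf (K x) y * measure_pmf.prob (?L t y) (- S))"
      using K[OF Suc.prems] fin by (subst integral_measure_pmf[of \<Omega>]) auto
    also have "\<dots> \<le> (\<Sum>y\<in>\<Omega>. pmf (K x) y * exit_prob \<Omega> S K t y)"
      using Suc.IH by (intro sum_mono mult_left_mono) auto
    finally show ?thesis using True by simp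
  next
    case False
    then show ?thesis by (simp add: measure_pmf.prob_le_1 del: funpow.simps)
  qed
qed

text \<open>Start from the stationary mass restricted to \<open>S\<close>. By invariance a step
  inside \<open>S\<close> never lifts the mass of a state above \<open>m\<close>, so each step loses
  at most the mass of \<open>Bd\<close>, and \<open>t\<close> steps lose at most \<open>t\<close>
  times as much. Averaging over \<open>S\<close> yields a good state, and monotonicity of the exit
  probability covers all earlier times.\<close>

lemma metastable_start:
  assumes m: "\<And>x. x \<in> \<Omega> \<Longrightarrow> 0 \<le> m x"
    and invariant: "\<And>y. y \<in> \<Omega> \<Longrightarrow> (\<Sum>x\<in>\<Omega>. m x * pmf (K x) y) = m y"
    and Bd: "Bd \<subseteq> S" and exits: "\<And>x. x \<in> S \<Longrightarrow> x \<notin> Bd \<Longrightarrow> set_pmf (K x) \<subseteq> S"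
    and pos: "0 < sum m S"
  shows "\<exists>x\<in>S. \<forall>s\<le>t. measure_pmf.prob (((\<lambda>\<nu>. bind_pmf \<nu> K) ^^ s) (return_pmf x)) (- S) * sum m S
           \<le> real t * sum m Bd"
proof -
  let ?h = "exit_prob \<Omega> S K"
  have finS: "finite S" using S fin finite_subset by blast
  have total: "(\<Sum>x\<in>S. m x * ?h t x) \<le> real t * sum m Bd" for t
  proof (induction t)
    case 0
    then show ?case by simp
  next
    case (Suc t)
    have leave: "(\<Sum>y\<in>\<Omega> - S. pmf (K x) y) \<le> (if x \<in> Bd then 1 else 0)" if "x \<in> S" for x
    proof (cases "x \<in> Bd")
      case True
      have "(\<Sum>y\<in>\<Omega> - S. pmf (K x) y) \<le> (\<Sum>y\<in>\<Omega>. pmf (K x) y)"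
        using fin by (intro sum_mono2) auto
      then show ?thesis using True sum_pmf_kernel[of x] that S by auto
    next
      case False
      then have "pmf (K x) y = 0" if "y \<in> \<Omega> - S" for y
        using exits[OF \<open>x \<in> S\<close>] that by (auto simp: set_pmf_iff)
      then show ?thesis using False by simp
    qed
    have "(\<Sum>x\<in>S. m x * ?h (Suc t) x) = (\<Sum>x\<in>S. m x * (\<Sum>y\<in>\<Omega>. pmf (K x) y * ?h t y))"
      by simp
    \<comment> \<open>Split by the next state: outside \<open>S\<close> the exit probability is
      already 1.\<close>
    also have "\<dots> = (\<Sum>x\<in>S. m x * (\<Sum>y\<in>S. pmf (K x) y * ?h t y))
                  + (\<Sum>x\<in>S. m x * (\<Sum>y\<in>\<Omega> - S. pmf (K x) y))"
      unfolding sum.distrib [symmetric] distrib_left [symmetric]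
      by (intro sum.cong refl arg_cong2[where f = "(*)"], subst sum.subset_diff[OF S fin])
        (simp add: exit_prob_notin add.commute)
    also have "(\<Sum>x\<in>S. m x * (\<Sum>y\<in>S. pmf (K x) y * ?h t y)) \<le> (\<Sum>y\<in>S. m y * ?h t y)"
    proof -
      have "(\<Sum>x\<in>S. m x * (\<Sum>y\<in>S. pmf (K x) y * ?h t y)) = (\<Sum>y\<in>S. (\<Sum>x\<in>S. m x * pmf (K x) y) * ?h t y)"
        unfolding sum_distrib_left sum_distrib_right by (subst sum.swap) (simp add: mult.assoc)
      also have "\<dots> \<le> (\<Sum>y\<in>S. m y * ?h t y)"
      proof (intro sum_mono mult_right_mono)
        fix y assume y: "y \<in> S"
        have "(\<Sum>x\<in>S. m x * pmf (K x) y) \<le> (\<Sum>x\<in>\<Omega>. m x * pmf (K x) y)"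
          using S fin m by (intro sum_mono2) auto
        then show "(\<Sum>x\<in>S. m x * pmf (K x) y) \<le> m y" using invariant y S by auto
        show "0 \<le> ?h t y" using exit_prob_bounds y S by blast
      qed
      finally show ?thesis .
    qed
    also have "(\<Sum>x\<in>S. m x * (\<Sum>y\<in>\<Omega> - S. pmf (K x) y)) \<le> (\<Sum>x\<in>S. m x * (if x \<in> Bd then 1 else 0))"
      using m S by (intro sum_mono mult_left_mono leave) auto
    also have "(\<Sum>x\<in>S. m x * (if x \<in> Bd then 1 else 0)) = sum m Bd"
      using finS Bd by (simp add: if_distrib sum.If_cases Int_absorb1 cong: if_cong)
    finally show ?case using Suc by (simp add: algebra_simps)
  qed
  have "\<exists>x\<in>S. ?h t x * sum m S \<le> real t * sum m Bd"
  proof (rule ccontr)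
    assume "\<not> ?thesis"
    then have *: "real t * sum m Bd < ?h t x * sum m S" if "x \<in> S" for x
      using that by force
    \<comment> \<open>The averaging contradiction needs one strict inequality, hence a state that
      carries mass.\<close>
    obtain z where z: "z \<in> S" "0 < m z"
      using pos by (metis not_le sum_nonpos)
    have "(\<Sum>x\<in>S. m x * (real t * sum m Bd)) < (\<Sum>x\<in>S. m x * (?h t x * sum m S))"
    proof (rule sum_strict_mono_ex1)
      show "\<forall>x\<in>S. m x * (real t * sum m Bd) \<le> m x * (?h t x * sum m S)"
        using m S by (intro ballI mult_left_mono less_imp_le[OF *]) auto
      show "\<exists>x\<in>S. m x * (real t * sum m Bd) < m x * (?h t x * sum m S)"
        using *[OF z(1)] z by (intro bexI[of _ z]) auto
    qed (use finS in auto)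
    then have "sum m S * (real t * sum m Bd) < (\<Sum>x\<in>S. m x * ?h t x) * sum m S"
      by (simp only: sum_distrib_right mult.assoc)
    then have "real t * sum m Bd < (\<Sum>x\<in>S. m x * ?h t x)"
      using pos by (simp add: mult.commute)
    with total[of t] show False by simp
  qed
  then obtain x where x: "x \<in> S" "?h t x * sum m S \<le> real t * sum m Bd"
    by blast
  show ?thesis
  proof (intro bexI[OF _ x(1)] allI impI)
    fix s assume "s \<le> t"
    then have "measure_pmf.prob (((\<lambda>\<nu>. bind_pmf \<nu> K) ^^ s) (return_pmf x)) (- S) \<le> ?h t x"
      using prob_outside_le_exit_prob[of x s] exit_prob_mono[of s t x] x(1) S by force
    then show "measure_pmf.prob (((\<lambda>\<nu>. bind_pmf \<nu> K) ^^ s) (return_pmf x)) (- S) * sum m S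
      \<le> real t * sum m Bd"
      using x(2) pos by (meson less_imp_le mult_right_mono order_trans)
  qed
qed

end

section \<open>The Glauber dynamics\<close>

text \<open>The unnormalised stationary measure: for \<open>l = p / (1 - p)\<close> the probability
  of a graph is proportional to \<open>l ^ card G\<close>, and conditioning on triangle-freeness
  only changes the normalisation.\<close>

definition weight :: "real \<Rightarrow> 'a set set \<Rightarrow> real" where
  "weight l F = (\<Sum>G\<in>F. l ^ card G)"

lemma weight_mono: "finite F' \<Longrightarrow> F \<subseteq> F' \<Longrightarrow> 0 \<le> l \<Longrightarrow> weight l F \<le> weight l F'"
  unfolding weight_def by (intro sum_mono2) auto

lemma weight_nonneg: "0 \<le> l \<Longrightarrow> 0 \<le> weight l F"
  unfolding weight_def by (intro sum_nonneg) auto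

lemma weight_Un: "finite F \<Longrightarrow> finite F' \<Longrightarrow> weight l (F \<union> F') + weight l (F \<inter> F') = weight l F + weight l F'"
  unfolding weight_def by (rule sum.union_inter)

lemma weight_Un_le: "finite F \<Longrightarrow> finite F' \<Longrightarrow> 0 \<le> l \<Longrightarrow> weight l (F \<union> F') \<le> weight l F + weight l F'"
  using weight_Un[of F F' l] weight_nonneg[of l "F \<inter> F'"] by simp

lemma weight_UN_le:
  assumes "finite I" "\<And>i. i \<in> I \<Longrightarrow> finite (F i)" "0 \<le> l"
  shows "weight l (\<Union>i\<in>I. F i) \<le> (\<Sum>i\<in>I. weight l (F i))"
  using assms
proof (induction I rule: finite_induct)
  case empty
  then show ?case by (simp add: weight_def)
next
  case (insert i I)
  then show ?case using weight_Un_le[of "F i" "\<Union>i\<in>I. F i" l] by simp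
qed

lemma finite_triangle_free_graphs: "finite (triangle_free_graphs n)"
  unfolding triangle_free_graphs_def
  by (rule finite_subset[of _ "Pow (nsets {1..n} 2)"]) (auto intro: finite_imp_finite_nsets)

lemma triangle_free_mono: "triangle_free G \<Longrightarrow> H \<subseteq> G \<Longrightarrow> triangle_free H"
  unfolding triangle_free_def by blast

lemma pmf_gnp:
  assumes p: "0 < p" "p < 1" and G: "G \<subseteq> nsets {1..n} 2"
  shows "pmf (gnp n p) G = (1 - p) ^ card (nsets {1..n} 2) * (p / (1 - p)) ^ card G"
proof -
  let ?E = "nsets {1..n} 2"
  let ?P = "Pi_pmf ?E False (\<lambda>_. bernoulli_pmf p)"
  have E: "finite ?E" by (simp add: finite_imp_finite_nsets)
  have GE: "{e \<in> ?E. e \<in> G} = G" using G by blast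
  have val: "pmf ?P (\<lambda>e. e \<in> G) = (1 - p) ^ card ?E * (p / (1 - p)) ^ card G"
  proof -
    have "pmf ?P (\<lambda>e. e \<in> G) = (\<Prod>e\<in>?E. pmf (bernoulli_pmf p) (e \<in> G))"
      using G E by (subst pmf_Pi') auto
    also have "\<dots> = (\<Prod>e\<in>?E. (1 - p) * (if e \<in> G then p / (1 - p) else 1))"
      using p by (intro prod.cong) auto
    also have "\<dots> = (1 - p) ^ card ?E * (p / (1 - p)) ^ card G"
      using E G by (simp add: prod.distrib prod.If_cases Int_absorb1 GE)
    finally show ?thesis .
  qed
  have "pmf (map_pmf (\<lambda>f. {e \<in> ?E. f e}) ?P) {e \<in> ?E. e \<in> G} = pmf ?P (\<lambda>e. e \<in> G)"
  proof (rule pmf_map_inj)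
    show "inj_on (\<lambda>f. {e \<in> ?E. f e}) (set_pmf ?P)"
    proof (rule inj_onI, rule ext)
      fix f g e assume fg: "f \<in> set_pmf ?P" "g \<in> set_pmf ?P" "{e \<in> ?E. f e} = {e \<in> ?E. g e}"
      \<comment> \<open>Off the set of pairs both functions take the default value of
        \<open>Pi_pmf\<close>, so the edge set determines the function.\<close>
      have "f e = False" "g e = False" if "e \<notin> ?E"
        using that fg(1,2) set_Pi_pmf_subset[OF E, of False] by blast+
      then show "f e = g e" using fg(3) by blast
    qed
    show "(\<lambda>e. e \<in> G) \<in> set_pmf ?P"
      using val p by (auto simp: set_pmf_iff)
  qed
  then show ?thesis unfolding gnp_def GE val .
qed

lemma weight_triangle_free_graphs_pos: "0 \<le> l \<Longrightarrow> 1 \<le> weight l (triangle_free_graphs n)"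
  using weight_mono[OF finite_triangle_free_graphs[of n], of "{{}}" l]
  by (simp add: weight_def triangle_free_graphs_def triangle_free_def)

lemma pmf_gnp_triangle_free:
  assumes p: "0 < p" "p < 1"
  shows "pmf (gnp_triangle_free n p) G = (if G \<in> triangle_free_graphs n
     then (p / (1 - p)) ^ card G / weight (p / (1 - p)) (triangle_free_graphs n) else 0)"
proof -
  let ?l = "p / (1 - p)" and ?T = "triangle_free_graphs n" and ?N = "card (nsets {1..n} 2)"
  have prob: "measure_pmf.prob (gnp n p) ?T = (1 - p) ^ ?N * weight ?l ?T"
    unfolding measure_measure_pmf_finite[OF finite_triangle_free_graphs] weight_def sum_distrib_left
    by (intro sum.cong) (auto simp: triangle_free_graphs_def pmf_gnp p)
  have "pmf (gnp n p) {} \<noteq> 0" using p by (simp add: pmf_gnp)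
  then have "{} \<in> set_pmf (gnp n p) \<inter> ?T"
    by (simp add: set_pmf_iff triangle_free_graphs_def triangle_free_def)
  then have ne: "set_pmf (gnp n p) \<inter> ?T \<noteq> {}" by blast
  have "pmf (gnp n p) G = (1 - p) ^ ?N * ?l ^ card G" if "G \<in> ?T"
    using that p by (intro pmf_gnp) (auto simp: triangle_free_graphs_def)
  then show ?thesis
    unfolding gnp_triangle_free_def pmf_cond[OF ne] prob using p by simp
qed

lemma prob_gnp_triangle_free:
  assumes p: "0 < p" "p < 1" and S: "S \<subseteq> triangle_free_graphs n"
  shows "measure_pmf.prob (gnp_triangle_free n p) S
    = weight (p / (1 - p)) S / weight (p / (1 - p)) (triangle_free_graphs n)"
proof -
  have "finite S" using S finite_triangle_free_graphs finite_subset by blast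
  then have "measure_pmf.prob (gnp_triangle_free n p) S = (\<Sum>G\<in>S. pmf (gnp_triangle_free n p) G)"
    by (rule measure_measure_pmf_finite)
  also have "\<dots> = weight (p / (1 - p)) S / weight (p / (1 - p)) (triangle_free_graphs n)"
    unfolding weight_def[of _ S] sum_divide_distrib
    using S by (intro sum.cong) (auto simp: pmf_gnp_triangle_free[OF p])
  finally show ?thesis .
qed

section \<open>Detailed balance for the update of a single pair\<close>

definition resample :: "real \<Rightarrow> 'a set set \<Rightarrow> 'a set \<Rightarrow> 'a set set pmf" where
  "resample p G e = (if triangle_free (insert e G)
       then map_pmf (\<lambda>b. if b then insert e G else G - {e}) (bernoulli_pmf p)
       else return_pmf (G - {e}))"

lemma pmf_resample:
  assumes p: "0 < p" "p < 1"
  shows "pmf (resample p G e) H = (if triangle_free (insert e G)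
     then (if H = insert e G then p else if H = G - {e} then 1 - p else 0)
     else (if H = G - {e} then 1 else 0))"
proof (cases "triangle_free (insert e G)")
  case True
  have ne: "insert e G \<noteq> G - {e}" by blast
  let ?f = "\<lambda>b. if b then insert e G else G - {e}"
  have inj: "inj ?f" using ne by (auto simp: inj_def)
  have "pmf (map_pmf ?f (bernoulli_pmf p)) (?f True) = p"
    "pmf (map_pmf ?f (bernoulli_pmf p)) (?f False) = 1 - p"
    using p by (subst pmf_map_inj'[OF inj], simp)+
  moreover have "pmf (map_pmf ?f (bernoulli_pmf p)) H = 0" if "H \<noteq> insert e G" "H \<noteq> G - {e}"
    using that by (auto simp: pmf_eq_0_set_pmf)
  ultimately show ?thesis using True ne by (auto simp: resample_def)
next
  case False
  then show ?thesis by (auto simp: resample_def indicator_def)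
qed

text \<open>Detailed balance for a fixed pair: two distinct states that communicate differ exactly
  in \<open>e\<close>, their weights have ratio \<open>p / (1 - p)\<close>, and so do the
  probabilities of inserting and deleting \<open>e\<close>. If \<open>e\<close> would close a
  triangle, both states lack \<open>e\<close> and coincide.\<close>

lemma resample_reversible:
  assumes p: "0 < p" "p < 1" and G: "finite G" "triangle_free G" and H: "finite H" "triangle_free H"
  shows "(p / (1 - p)) ^ card G * pmf (resample p G e) H = (p / (1 - p)) ^ card H * pmf (resample p H e) G"
proof (cases "G - {e} = H - {e}")
  case True
  show ?thesis
  proof (cases "triangle_free (insert e G)")
    case tf: True
    have add: "pmf (resample p (insert e F) e) F = 1 - p \<and> pmf (resample p F e) (insert e F) = p"
      if "e \<notin> F" "triangle_free (insert e F)" for F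
      unfolding pmf_resample[OF p] using that by auto
    have "insert e (G - {e}) = insert e (H - {e})" using True by simp
    then have eq: "insert e G = insert e H" by simp
    consider "G = H" | "G = insert e H" "e \<notin> H" | "H = insert e G" "e \<notin> G"
      using True eq by (metis Diff_insert_absorb insert_absorb)
    then show ?thesis
    proof cases
      case 2
      then show ?thesis using add[of H] tf H(1) p by simp
    next
      case 3
      then show ?thesis using add[of G] tf G(1) p by simp
    qed simp
  next
    case False
    then have "G = H" using G(2) H(2) True by (metis Diff_insert_absorb insert_Diff_single insert_absorb)
    then show ?thesis by simp
  qed
next
  case False
  then have "pmf (resample p G e) H = 0" "pmf (resample p H e) G = 0"
    by (auto simp: pmf_resample p)
  then show ?thesis by simp
qed

lemma glauber_step_resample: "glauber_step n p G = bind_pmf (pmf_of_set (nsets {1..n} 2)) (resample p G)"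
  unfolding glauber_step_def resample_def by simp

lemma nsets_2_nonempty: "2 \<le> (n::nat) \<Longrightarrow> nsets {1..n} 2 \<noteq> {}"
  by (simp add: nsets_eq_empty_iff)

lemma set_resample: "H \<in> set_pmf (resample p G e) \<Longrightarrow> H = G - {e} \<or> H = insert e G \<and> triangle_free (insert e G)"
  by (auto simp: resample_def split: if_splits)

lemma set_glauber_step:
  assumes "2 \<le> n" "H \<in> set_pmf (glauber_step n p G)"
  shows "\<exists>e\<in>nsets {1..n} 2. H = G - {e} \<or> H = insert e G \<and> triangle_free (insert e G)"
proof -
  have "finite (nsets {1..n} 2)" by (simp add: finite_imp_finite_nsets)
  then show ?thesis
    using assms(2) set_resample[of H p G] nsets_2_nonempty[OF assms(1)]
    unfolding glauber_step_resample set_bind_pmf by (auto simp: set_pmf_of_set)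
qed

lemma glauber_step_closed:
  assumes "2 \<le> n" "G \<in> triangle_free_graphs n"
  shows "set_pmf (glauber_step n p G) \<subseteq> triangle_free_graphs n"
proof
  fix H assume "H \<in> set_pmf (glauber_step n p G)"
  from set_glauber_step[OF assms(1) this] show "H \<in> triangle_free_graphs n"
    using assms(2) triangle_free_mono[of G H] by (auto simp: triangle_free_graphs_def)
qed

lemma glauber_step_invariant:
  assumes n: "2 \<le> n" and p: "0 < p" "p < 1" and H: "H \<in> triangle_free_graphs n"
  shows "(\<Sum>G\<in>triangle_free_graphs n. (p / (1 - p)) ^ card G * pmf (glauber_step n p G) H)
    = (p / (1 - p)) ^ card H"
proof -
  let ?E = "nsets {1..n} 2" and ?T = "triangle_free_graphs n"
  have E: "finite ?E" "?E \<noteq> {}" using n nsets_2_nonempty by (auto simp: finite_imp_finite_nsets)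
  have T: "finite G \<and> triangle_free G" if "G \<in> ?T" for G
    using that E(1) finite_subset by (auto simp: triangle_free_graphs_def)
  have "(\<Sum>G\<in>?T. (p / (1 - p)) ^ card G * pmf (glauber_step n p G) H)
      = (\<Sum>G\<in>?T. (p / (1 - p)) ^ card H * pmf (glauber_step n p H) G)"
  proof (intro sum.cong refl)
    fix G assume G: "G \<in> ?T"
    have "(\<Sum>e\<in>?E. (p / (1 - p)) ^ card G * pmf (resample p G e) H)
        = (\<Sum>e\<in>?E. (p / (1 - p)) ^ card H * pmf (resample p H e) G)"
      using T[OF G] T[OF H] by (intro sum.cong refl resample_reversible p) auto
    then show "(p / (1 - p)) ^ card G * pmf (glauber_step n p G) H
        = (p / (1 - p)) ^ card H * pmf (glauber_step n p H) G"
      unfolding glauber_step_resample pmf_bind_pmf_of_set[OF E(2,1)] times_divide_eq_right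
        sum_distrib_left by simp
  qed
  also have "\<dots> = (p / (1 - p)) ^ card H * (\<Sum>G\<in>?T. pmf (glauber_step n p H) G)"
    by (simp add: sum_distrib_left)
  also have "(\<Sum>G\<in>?T. pmf (glauber_step n p H) G) = 1"
    using glauber_step_closed[OF n H] by (intro sum_pmf_eq_1 finite_triangle_free_graphs)
  finally show ?thesis by simp
qed

section \<open>From a bottleneck to a lower bound on the mixing time\<close>

lemma tv_dist_ge: "\<bar>measure_pmf.prob P A - measure_pmf.prob Q A\<bar> \<le> tv_dist P Q"
  unfolding tv_dist_def
proof (rule cSUP_upper)
  show "bdd_above (range (\<lambda>A. \<bar>measure_pmf.prob P A - measure_pmf.prob Q A\<bar>))"
    proof (rule bdd_aboveI[of _ 1], safe)
      fix A
      show "\<bar>measure_pmf.prob P A - measure_pmf.prob Q A\<bar> \<le> 1"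
        using measure_pmf.prob_le_1[of P A] measure_pmf.prob_le_1[of Q A]
          measure_nonneg[of "measure_pmf P" A] measure_nonneg[of "measure_pmf Q" A] by linarith
    qed
qed simp

text \<open>From the metastable start the chain is outside \<open>S\<close> with probability at most
  \<open>m * r\<close> up to the mixing time \<open>m\<close>, whereas equilibrium puts at least
  \<open>3 / 8\<close> outside. As \<open>S\<close> is closed under deleting edges, only insertions
  can leave it, which is why \<open>Bd\<close> has to account for insertions alone.\<close>

lemma glauber_mixing_time_bottleneck:
  assumes n: "2 \<le> n" and p: "0 < p" "p < 1" and r: "0 < r"
    and S: "S \<subseteq> triangle_free_graphs n" "{} \<in> S" and down: "\<And>G H. G \<in> S \<Longrightarrow> H \<subseteq> G \<Longrightarrow> H \<in> S"
    and Bd: "Bd \<subseteq> S"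
      "\<And>G e. G \<in> S \<Longrightarrow> insert e G \<in> triangle_free_graphs n \<Longrightarrow> insert e G \<notin> S \<Longrightarrow> G \<in> Bd"
    and flow: "weight (p / (1 - p)) Bd \<le> r * weight (p / (1 - p)) S"
    and half: "weight (p / (1 - p)) S \<le> 5 / 8 * weight (p / (1 - p)) (triangle_free_graphs n)"
  shows "ereal (1 / (8 * r)) \<le> ereal_of_enat (glauber_mixing_time n p)"
proof (cases "glauber_mixing_time n p")
  case infinity
  then show ?thesis by simp
next
  case (enat m)
  let ?l = "p / (1 - p)" and ?T = "triangle_free_graphs n"
  have l: "0 < ?l" using p by simp
  have fS: "finite S" using S(1) finite_triangle_free_graphs finite_subset by blast
  have Spos: "0 < weight ?l S"
    unfolding weight_def using fS S(2) l by (intro sum_pos) auto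
  have "\<exists>x\<in>S. \<forall>s\<le>m. measure_pmf.prob (((\<lambda>\<nu>. bind_pmf \<nu> (glauber_step n p)) ^^ s) (return_pmf x)) (- S)
     * (\<Sum>G\<in>S. ?l ^ card G) \<le> real m * (\<Sum>G\<in>Bd. ?l ^ card G)"
  proof (rule metastable_start[where \<Omega> = ?T])
    show "0 < (\<Sum>G\<in>S. ?l ^ card G)" using Spos by (simp only: weight_def)
    show "(\<Sum>G\<in>?T. ?l ^ card G * pmf (glauber_step n p G) H) = ?l ^ card H" if "H \<in> ?T" for H
      using that by (rule glauber_step_invariant[OF n p])
    show "set_pmf (glauber_step n p G) \<subseteq> ?T" if "G \<in> ?T" for G
      using that by (rule glauber_step_closed[OF n])
    show "0 \<le> ?l ^ card G" for G :: "nat set set" using l by simp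
    show "finite ?T" by (rule finite_triangle_free_graphs)
    show "set_pmf (glauber_step n p G) \<subseteq> S" if "G \<in> S" "G \<notin> Bd" for G
    proof
      fix H assume "H \<in> set_pmf (glauber_step n p G)"
      from set_glauber_step[OF n this] obtain e where e: "e \<in> nsets {1..n} 2"
        "H = G - {e} \<or> H = insert e G \<and> triangle_free (insert e G)" by blast
      have "insert e G \<in> ?T" if "triangle_free (insert e G)"
        using that e(1) \<open>G \<in> S\<close> S(1) by (auto simp: triangle_free_graphs_def)
      then show "H \<in> S" using e(2) down[OF \<open>G \<in> S\<close>, of "G - {e}"] Bd(2)[OF \<open>G \<in> S\<close>] \<open>G \<notin> Bd\<close> by blast
    qed
  qed (fact S(1) Bd(1))+
  then obtain x where x: "x \<in> S"
    and stay: "\<And>s. s \<le> m \<Longrightarrow> measure_pmf.prob (glauber_law n p x s) (- S) * weight ?l S \<le> real m * weight ?l Bd"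
    unfolding glauber_law_def weight_def by blast
  let ?M = "{t. tv_dist (glauber_law n p x t) (gnp_triangle_free n p) < 1 / 4}"
  have "(INF t\<in>?M. enat t) \<le> enat m"
    unfolding enat[symmetric] glauber_mixing_time_def using x S(1) by (intro SUP_upper) auto
  \<comment> \<open>An infimum over no times would be infinite; finiteness of the mixing time
    provides an actual time \<open>s \<le> m\<close> at which the chain started from
    \<open>x\<close> is close to equilibrium.\<close>
  then have "\<not> (\<forall>t\<in>?M. enat (Suc m) \<le> enat t)"
    using INF_greatest[of ?M "enat (Suc m)" enat] by (meson Suc_n_not_le_n enat_ord_simps(1) order_trans)
  then obtain s where s: "s \<le> m" "tv_dist (glauber_law n p x s) (gnp_triangle_free n p) < 1 / 4"
    using not_less_eq_eq by auto
  have out: "measure_pmf.prob (glauber_law n p x s) (- S) \<le> real m * r"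
  proof -
    have "measure_pmf.prob (glauber_law n p x s) (- S) * weight ?l S \<le> real m * (r * weight ?l S)"
      using stay[OF s(1)] flow by (meson mult_left_mono of_nat_0_le_iff order_trans)
    then show ?thesis using Spos by (simp add: mult.assoc[symmetric])
  qed
  have "measure_pmf.prob (gnp_triangle_free n p) S \<le> 5 / 8"
  proof -
    have "0 < weight ?l ?T" using weight_triangle_free_graphs_pos[of ?l n] l by linarith
    then show ?thesis unfolding prob_gnp_triangle_free[OF p S(1)] using half by (simp add: pos_divide_le_eq)
  qed
  moreover have "measure_pmf.prob (glauber_law n p x s) S = 1 - measure_pmf.prob (glauber_law n p x s) (- S)"
    using measure_pmf.prob_compl[of S "glauber_law n p x s"] by (simp add: Compl_eq_Diff_UNIV)
  \<comment> \<open>The set \<open>S\<close> has probability at least \<open>1 - m * r\<close> at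
    time \<open>s\<close> and at most \<open>5 / 8\<close> in equilibrium. The gap between
    \<open>3 / 8\<close> and \<open>1 / 4\<close> is the \<open>1 / 8\<close> of the final
    bound.\<close>
  ultimately have "3 / 8 - real m * r < 1 / 4"
    using tv_dist_ge[of "glauber_law n p x s" S "gnp_triangle_free n p"] s(2) out by linarith
  then have "1 / (8 * r) \<le> real m" using r by (simp add: divide_simps mult_ac)
  then show ?thesis using enat by simp
qed

section \<open>Switchings near a bipartition\<close>

text \<open>A lower bound for the partition function \<open>Z\<close> of the hard-core model. Adding
  a vertex \<open>a\<close> with neighbourhood \<open>N\<close> contributes
  \<open>x * Z (Q - N)\<close>, and dropping at most \<open>D\<close> vertices costs at most
  \<open>(1 + x) ^ D \<le> 2\<close>; hence each vertex multiplies \<open>Z\<close> by at least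
  \<open>1 + x / 2\<close>.\<close>

lemma independent_sets_weight_ge:
  fixes R :: "'a \<Rightarrow> 'a \<Rightarrow> bool" and x :: real
  assumes P: "finite P" and x: "0 \<le> x" and sym: "\<And>a b. R a b \<Longrightarrow> R b a"
    and deg: "\<And>a. a \<in> P \<Longrightarrow> card {b\<in>P. R a b} \<le> D" and small: "(1 + x) ^ D \<le> 2"
  shows "(1 + x / 2) ^ card P \<le> (\<Sum>T | T \<subseteq> P \<and> (\<forall>a\<in>T. \<forall>b\<in>T. a \<noteq> b \<longrightarrow> \<not> R a b). x ^ card T)"
proof -
  define I where "I Q = {T. T \<subseteq> Q \<and> (\<forall>a\<in>T. \<forall>b\<in>T. a \<noteq> b \<longrightarrow> \<not> R a b)}" for Q
  define Z where "Z Q = (\<Sum>T\<in>I Q. x ^ card T)" for Q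
  have fI: "finite (I Q)" if "finite Q" for Q
    using that by (auto simp: I_def intro: finite_subset[of _ "Pow Q"])
  have ZI: "Z Q \<ge> 0" for Q unfolding Z_def using x by (intro sum_nonneg) auto
  have fin: "finite T" if "T \<in> I Q" "finite Q" for T Q
    using that finite_subset by (auto simp: I_def)
  have ins: "(\<Sum>T\<in>insert a ` J. x ^ card T) = x * (\<Sum>T\<in>J. x ^ card T)"
    if "\<forall>T\<in>J. finite T \<and> a \<notin> T" for a J
  proof -
    have "inj_on (insert a) J" using that by (metis Diff_insert_absorb inj_onI)
    then show ?thesis using that by (simp add: sum.reindex sum_distrib_left)
  qed
  have up1: "Z (insert a Q) \<le> (1 + x) * Z Q" if Q: "finite Q" "a \<notin> Q" for a Q
  proof -
    have sub: "I (insert a Q) \<subseteq> I Q \<union> insert a ` I Q"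
    proof
      fix T assume T: "T \<in> I (insert a Q)"
      show "T \<in> I Q \<union> insert a ` I Q"
      proof (cases "a \<in> T")
        case True
        then have "T = insert a (T - {a})" "T - {a} \<in> I Q" using T by (auto simp: I_def)
        then show ?thesis by blast
      next
        case False
        then show ?thesis using T by (auto simp: I_def)
      qed
    qed
    have "Z (insert a Q) \<le> (\<Sum>T\<in>I Q \<union> insert a ` I Q. x ^ card T)"
      unfolding Z_def using sub fI[OF Q(1)] x by (intro sum_mono2) auto
    also have "\<dots> \<le> (\<Sum>T\<in>I Q. x ^ card T) + (\<Sum>T\<in>insert a ` I Q. x ^ card T)"
      using sum.union_inter[of "I Q" "insert a ` I Q" "\<lambda>T. x ^ card T"] fI[OF Q(1)] x
        sum_nonneg[of "I Q \<inter> insert a ` I Q" "\<lambda>T. x ^ card T"] by simp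
    also have "(\<Sum>T\<in>insert a ` I Q. x ^ card T) = x * (\<Sum>T\<in>I Q. x ^ card T)"
      using Q fin[OF _ Q(1)] by (intro ins) (auto simp: I_def)
    finally show ?thesis by (simp add: Z_def algebra_simps)
  qed
  have up: "Z (Q \<union> N) \<le> (1 + x) ^ card N * Z Q" if "finite Q" "finite N" "Q \<inter> N = {}" for Q N
    using that(2,3)
  proof (induction N rule: finite_induct)
    case (insert a N)
    then have "Z (Q \<union> insert a N) \<le> (1 + x) * Z (Q \<union> N)"
      using up1[of "Q \<union> N" a] that(1) by auto
    also have "\<dots> \<le> (1 + x) * ((1 + x) ^ card N * Z Q)"
      using insert x by (intro mult_left_mono) auto
    finally show ?case using insert by (simp add: mult.assoc)
  qed simp
  have down: "(1 + x / 2) ^ card Q \<le> Z Q" if "Q \<subseteq> P" for Q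
  proof -
    have "finite Q" using that P finite_subset by blast
    from this that show ?thesis
    proof (induction Q rule: finite_induct)
      case empty
      have "I {} = {{}}" by (auto simp: I_def)
      then show ?case by (simp add: Z_def)
    next
      case (insert a Q)
      define N where "N = {b\<in>Q. R a b}"
      have N: "N \<subseteq> Q" "finite N" "finite (Q - N)" using insert.hyps by (auto simp: N_def)
      have "card N \<le> D"
      proof -
        have "card N \<le> card {b\<in>P. R a b}" using insert.prems P by (intro card_mono) (auto simp: N_def)
        then show ?thesis using deg[of a] insert.prems by simp
      qed
      then have "(1 + x) ^ card N \<le> 2"
        using small x power_increasing[of "card N" D "1 + x"] by linarith
      then have "(1 + x) ^ card N * Z (Q - N) \<le> 2 * Z (Q - N)"
        using ZI[of "Q - N"] by (rule mult_right_mono)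
      moreover have "Q - N \<union> N = Q" using N(1) by blast
      ultimately have "Z Q \<le> 2 * Z (Q - N)"
        using up[OF N(3,2)] by fastforce
      moreover have "Z Q + x * Z (Q - N) \<le> Z (insert a Q)"
      proof -
        have "x * Z (Q - N) = (\<Sum>T\<in>insert a ` I (Q - N). x ^ card T)"
          unfolding Z_def using insert.hyps fin[OF _ N(3)] by (subst ins) (auto simp: I_def)
        moreover have "Z Q + (\<Sum>T\<in>insert a ` I (Q - N). x ^ card T)
            = (\<Sum>T\<in>I Q \<union> insert a ` I (Q - N). x ^ card T)"
          unfolding Z_def using fI[OF insert.hyps(1)] fI[OF N(3)] insert.hyps(2)
          by (intro sum.union_disjoint[symmetric]) (auto simp: I_def)
        moreover have "I Q \<union> insert a ` I (Q - N) \<subseteq> I (insert a Q)"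
          using sym by (auto simp: I_def N_def) 
        then have "(\<Sum>T\<in>I Q \<union> insert a ` I (Q - N). x ^ card T) \<le> Z (insert a Q)"
          unfolding Z_def using fI[of "insert a Q"] insert.hyps(1) x by (intro sum_mono2) auto
        ultimately show ?thesis by simp
      qed
      ultimately have "(1 + x / 2) * Z Q \<le> Z (insert a Q)"
        using x mult_left_mono[of "Z Q / 2" "Z (Q - N)" x] by (simp add: algebra_simps)
      moreover have "(1 + x / 2) * (1 + x / 2) ^ card Q \<le> (1 + x / 2) * Z Q"
        using insert x by (intro mult_left_mono) auto
      ultimately show ?case using insert.hyps by simp
    qed
  qed
  show ?thesis using down[of P] by (simp add: Z_def I_def)
qed

section \<open>Neighbourhoods, stars and nearly bipartite graphs\<close>

definition nbrs :: "'a set set \<Rightarrow> 'a set \<Rightarrow> 'a \<Rightarrow> 'a set" where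
  "nbrs G X v = {u\<in>X. {v, u} \<in> G}"

definition near_bipartite :: "'a set \<Rightarrow> 'a set \<Rightarrow> nat \<Rightarrow> 'a set set set" where
  "near_bipartite A B d = {G. G \<subseteq> nsets (A \<union> B) 2 \<and> triangle_free G \<and>
     (\<forall>v\<in>A. card (nbrs G A v) \<le> d) \<and> (\<forall>v\<in>B. card (nbrs G B v) \<le> d)}"

lemma near_bipartite_commute: "near_bipartite A B d = near_bipartite B A d"
  by (auto simp: near_bipartite_def Un_commute)

lemma nbrs_subset: "nbrs G X v \<subseteq> X"
  by (auto simp: nbrs_def)

lemma finite_nbrs: "finite X \<Longrightarrow> finite (nbrs G X v)"
  by (simp add: nbrs_def)

lemma card_nbrs_mono: "finite Y \<Longrightarrow> G \<subseteq> H \<Longrightarrow> X \<subseteq> Y \<Longrightarrow> card (nbrs G X v) \<le> card (nbrs H Y v)"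
  by (rule card_mono) (auto simp: nbrs_def)

definition star :: "'a \<Rightarrow> 'a set \<Rightarrow> 'a set set" where
  "star v U = (\<lambda>u. {v, u}) ` U"

lemma mem_star: "{a, b} \<in> star v U \<longleftrightarrow> a = v \<and> b \<in> U \<or> b = v \<and> a \<in> U"
  by (auto simp: star_def doubleton_eq_iff)

lemma inj_on_star: "inj_on (\<lambda>u. {v, u}) U"
  by (auto simp: inj_on_def doubleton_eq_iff)

lemma card_star: "card (star v U) = card U"
  unfolding star_def by (rule card_image[OF inj_on_star])

lemma finite_star: "finite U \<Longrightarrow> finite (star v U)"
  by (simp add: star_def)

section \<open>Comparing weights by deleting and adding edges\<close>

lemma weight_remove_le:
  assumes F: "finite F" "\<And>G. G \<in> F \<Longrightarrow> finite G" and F': "finite F'" and l: "0 \<le> l"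
    and X: "\<And>G. G \<in> F \<Longrightarrow> X \<subseteq> G" "\<And>G. G \<in> F \<Longrightarrow> G - X \<in> F'"
  shows "weight l F \<le> l ^ card X * weight l F'"
proof -
  have "inj_on (\<lambda>G. G - X) F" using X(1) by (metis (no_types, lifting) Diff_partition inj_onI)
  then have "weight l ((\<lambda>G. G - X) ` F) = (\<Sum>G\<in>F. l ^ card (G - X))"
    unfolding weight_def by (simp add: sum.reindex)
  moreover have "weight l ((\<lambda>G. G - X) ` F) \<le> weight l F'"
    using F' X(2) l by (intro weight_mono) auto
  moreover have "weight l F = (\<Sum>G\<in>F. l ^ card X * l ^ card (G - X))"
    unfolding weight_def
  proof (intro sum.cong refl)
    fix G assume G: "G \<in> F"
    then have "card G = card X + card (G - X)"
      using X(1)[OF G] F(2)[OF G] by (metis Diff_disjoint Diff_partition card_Un_disjoint finite_Diff finite_subset)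
    then show "l ^ card G = l ^ card X * l ^ card (G - X)" by (simp add: power_add)
  qed
  ultimately show ?thesis using l by (simp add: sum_distrib_left[symmetric] mult_left_mono)
qed

text \<open>Every graph \<open>G\<close> of \<open>F\<close> spawns the graphs
  \<open>G \<union> \<phi> T\<close>. The new graph alone determines \<open>T\<close> through
  \<open>\<psi>\<close>, and then \<open>G\<close> by removing \<open>\<phi> T\<close>, so all
  offspring are distinct; the offspring of one \<open>G\<close> together weigh at least
  \<open>c\<close> times as much as \<open>G\<close>.\<close>

lemma weight_switching:
  assumes F: "finite F" and F': "finite F'" and J: "\<And>G. G \<in> F \<Longrightarrow> finite (J G)" and l: "0 \<le> l"
    and into: "\<And>G T. G \<in> F \<Longrightarrow> T \<in> J G \<Longrightarrow> G \<union> \<phi> T \<in> F'"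
    and card: "\<And>G T. G \<in> F \<Longrightarrow> T \<in> J G \<Longrightarrow> card (G \<union> \<phi> T) = card G + k * card T"
    and recover: "\<And>G T. G \<in> F \<Longrightarrow> T \<in> J G \<Longrightarrow> \<psi> (G \<union> \<phi> T) = T \<and> G \<inter> \<phi> T = {}"
    and gain: "\<And>G. G \<in> F \<Longrightarrow> c \<le> (\<Sum>T\<in>J G. (l ^ k) ^ card T)"
  shows "c * weight l F \<le> weight l F'"
proof -
  let ?f = "\<lambda>(G, T). G \<union> \<phi> T"
  have "inj_on ?f (Sigma F J)"
  proof (rule inj_onI, clarify)
    fix G T G' T' assume *: "G \<in> F" "T \<in> J G" "G' \<in> F" "T' \<in> J G'" "G \<union> \<phi> T = G' \<union> \<phi> T'"
    then have "T = T'" by (metis recover)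
    then show "G = G' \<and> T = T'" using * recover by blast
  qed
  then have "weight l (?f ` Sigma F J) = (\<Sum>(G, T)\<in>Sigma F J. l ^ card (G \<union> \<phi> T))"
    unfolding weight_def by (simp add: sum.reindex case_prod_unfold)
  also have "\<dots> = (\<Sum>G\<in>F. \<Sum>T\<in>J G. l ^ card (G \<union> \<phi> T))"
    using F J by (subst sum.Sigma) auto
  also have "\<dots> = (\<Sum>G\<in>F. l ^ card G * (\<Sum>T\<in>J G. (l ^ k) ^ card T))"
    unfolding sum_distrib_left by (intro sum.cong refl) (simp add: card power_add power_mult)
  also have "\<dots> \<ge> (\<Sum>G\<in>F. l ^ card G * c)"
    using gain l by (intro sum_mono mult_left_mono) auto
  finally have "c * weight l F \<le> weight l (?f ` Sigma F J)"
    by (simp add: weight_def sum_distrib_left mult.commute)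
  also have "\<dots> \<le> weight l F'"
    using F' into l by (intro weight_mono) auto
  finally show ?thesis .
qed

locale bipartition =
  fixes A B :: "'a set" and d :: nat
  assumes finA: "finite A" and finB: "finite B" and disj: "A \<inter> B = {}"
begin

lemma finite_near_bipartite: "finite (near_bipartite A B d)"
  by (rule finite_subset[of _ "Pow (nsets (A \<union> B) 2)"])
    (auto simp: near_bipartite_def finA finB finite_imp_finite_nsets)

lemma near_bipartite_finite: "G \<in> near_bipartite A B d \<Longrightarrow> finite G"
  using finA finB finite_subset[of G "nsets (A \<union> B) 2"]
  by (auto simp: near_bipartite_def finite_imp_finite_nsets)

lemma near_bipartite_mono:
  assumes G: "G \<in> near_bipartite A B d" and H: "H \<subseteq> G"
  shows "H \<in> near_bipartite A B d"
proof -
  have "card (nbrs H A v) \<le> d" if "v \<in> A" for v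
    using card_nbrs_mono[OF finA H order_refl, of v] G that by (force simp: near_bipartite_def)
  moreover have "card (nbrs H B v) \<le> d" if "v \<in> B" for v
    using card_nbrs_mono[OF finB H order_refl, of v] G that by (force simp: near_bipartite_def)
  ultimately show ?thesis
    using G H triangle_free_mono[of G H] by (auto simp: near_bipartite_def)
qed

lemma near_bipartite_edge:
  "G \<in> near_bipartite A B d \<Longrightarrow> {x, y} \<in> G \<Longrightarrow> x \<noteq> y \<and> x \<in> A \<union> B \<and> y \<in> A \<union> B"
  unfolding near_bipartite_def by (metis (lifting) doubleton_in_nsets_2 mem_Collect_eq subsetD)

text \<open>Cross edges leave the degrees inside the sides unchanged. A triangle is sorted by its
  number of new edges: three are impossible by bipartiteness, two and one are excluded by the
  assumptions, none by triangle-freeness of \<open>G\<close>.\<close>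

lemma add_cross_edges:
  assumes G: "G \<in> near_bipartite A B d" and X: "\<And>e. e \<in> X \<Longrightarrow> \<exists>a\<in>A. \<exists>w\<in>B. e = {a, w}"
    and one: "\<And>a w x. {a, w} \<in> X \<Longrightarrow> \<not> ({a, x} \<in> G \<and> {x, w} \<in> G)"
    and two: "\<And>x y z. y \<noteq> z \<Longrightarrow> {x, y} \<in> X \<Longrightarrow> {x, z} \<in> X \<Longrightarrow> {y, z} \<notin> G"
  shows "G \<union> X \<in> near_bipartite A B d"
proof -
  have cross: "a \<in> A \<and> b \<in> B \<or> a \<in> B \<and> b \<in> A" if "{a, b} \<in> X" for a b
    using X[OF that] by (auto simp: doubleton_eq_iff)
  have "nbrs (G \<union> X) A v = nbrs G A v" if "v \<in> A" for v
    using cross that disj by (auto simp: nbrs_def)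
  moreover have "nbrs (G \<union> X) B v = nbrs G B v" if "v \<in> B" for v
    using cross that disj by (auto simp: nbrs_def)
  moreover have "X \<subseteq> nsets (A \<union> B) 2"
    using X disj by (fastforce simp: doubleton_in_nsets_2)
  moreover have "triangle_free (G \<union> X)"
    unfolding triangle_free_def
  proof clarify
    fix x y z assume xyz: "x \<noteq> y" "y \<noteq> z" "x \<noteq> z" and
      e: "{x, y} \<in> G \<union> X" "{y, z} \<in> G \<union> X" "{x, z} \<in> G \<union> X"
    have "\<not> ({x, y} \<in> X \<and> {y, z} \<in> X \<and> {x, z} \<in> X)"
      using cross[of x y] cross[of y z] cross[of x z] disj by blast
    moreover have "\<not> ({x, y} \<in> X \<and> {y, z} \<in> G \<and> {x, z} \<in> G)"
      using one[of x y z] by (auto simp: insert_commute)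
    moreover have "\<not> ({x, y} \<in> G \<and> {y, z} \<in> X \<and> {x, z} \<in> G)"
      using one[of y z x] by (auto simp: insert_commute)
    moreover have "\<not> ({x, y} \<in> G \<and> {y, z} \<in> G \<and> {x, z} \<in> X)"
      using one[of x z y] by (auto simp: insert_commute)
    moreover have "\<not> ({x, y} \<in> X \<and> {y, z} \<in> X \<and> {x, z} \<in> G)"
      using two[of x z y] xyz by (auto simp: insert_commute)
    moreover have "\<not> ({x, y} \<in> X \<and> {y, z} \<in> G \<and> {x, z} \<in> X)"
      using two[of y z x] xyz by (auto simp: insert_commute)
    moreover have "\<not> ({x, y} \<in> G \<and> {y, z} \<in> X \<and> {x, z} \<in> X)"
      using two[of x y z] xyz by (auto simp: insert_commute)
    moreover have "\<not> ({x, y} \<in> G \<and> {y, z} \<in> G \<and> {x, z} \<in> G)"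
      using G xyz unfolding near_bipartite_def triangle_free_def by blast
    ultimately show False
      using e by blast
  qed
  ultimately show ?thesis using G by (auto simp: near_bipartite_def)
qed

text \<open>The vertices \<open>w\<close> of \<open>B\<close> for which the new edge \<open>{a, w}\<close> would close a triangle.\<close>

definition blocked :: "'a set set \<Rightarrow> 'a \<Rightarrow> 'a set" where
  "blocked G a = {w\<in>B. \<exists>x. {a, x} \<in> G \<and> {x, w} \<in> G}"

text \<open>Sort the paths \<open>a\<close>, \<open>x\<close>, \<open>w\<close> by the side of
  \<open>x\<close>. For \<open>x\<close> in \<open>A\<close> there are at most \<open>d\<close>
  choices of \<open>x\<close> and \<open>k\<close> of \<open>w\<close>; for \<open>x\<close> in
  \<open>B\<close> at most \<open>k\<close> choices of \<open>x\<close> and, since \<open>w\<close>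
  lies on the same side, \<open>d\<close> of \<open>w\<close>.\<close>

lemma card_blocked:
  assumes G: "G \<in> near_bipartite A B d" and a: "a \<in> A"
    and deg: "\<And>v. v \<in> A \<union> B \<Longrightarrow> card (nbrs G (A \<union> B) v) \<le> k"
  shows "card (blocked G a) \<le> 2 * d * k"
proof -
  let ?X = "nbrs G A a" and ?Y = "nbrs G B a"
  have fX: "finite ?X" "finite ?Y" by (simp_all add: finite_nbrs finA finB)
  have "blocked G a \<subseteq> (\<Union>x\<in>?X. nbrs G B x) \<union> (\<Union>y\<in>?Y. nbrs G B y)"
    using near_bipartite_edge[OF G] by (fastforce simp: blocked_def nbrs_def)
  then have "card (blocked G a) \<le> card ((\<Union>x\<in>?X. nbrs G B x) \<union> (\<Union>y\<in>?Y. nbrs G B y))"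
    using fX finB by (intro card_mono) (auto simp: finite_nbrs)
  also have "\<dots> \<le> card (\<Union>x\<in>?X. nbrs G B x) + card (\<Union>y\<in>?Y. nbrs G B y)"
    by (rule card_Un_le)
  also have "card (\<Union>x\<in>?X. nbrs G B x) \<le> (\<Sum>x\<in>?X. card (nbrs G B x))"
    by (rule card_UN_le[OF fX(1)])
  also have "\<dots> \<le> (\<Sum>x\<in>?X. k)"
  proof (rule sum_mono)
    fix x assume "x \<in> ?X"
    then have "x \<in> A \<union> B" by (simp add: nbrs_def)
    then show "card (nbrs G B x) \<le> k"
      using deg[of x] card_nbrs_mono[of "A \<union> B" G G B x] finA finB by fastforce
  qed
  also have "\<dots> = card ?X * k" by simp
  also have "\<dots> \<le> d * k" using G a by (intro mult_right_mono) (auto simp: near_bipartite_def)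
  also have "card (\<Union>y\<in>?Y. nbrs G B y) \<le> (\<Sum>y\<in>?Y. card (nbrs G B y))"
    by (rule card_UN_le[OF fX(2)])
  also have "\<dots> \<le> (\<Sum>y\<in>?Y. d)"
    using G by (intro sum_mono) (auto simp: near_bipartite_def nbrs_def)
  also have "\<dots> = card ?Y * d" by simp
  also have "\<dots> \<le> k * d"
    using deg[of a] a card_nbrs_mono[of "A \<union> B" G G B a] finA finB
    by (intro mult_right_mono) (auto intro: order_trans)
  finally show ?thesis by (simp add: algebra_simps)
qed

text \<open>Kept separate from \<open>near_bipartite\<close> because a switching may push degrees
  above \<open>k\<close>: only the graphs being switched must obey the cap, not the resulting
  ones.\<close>

definition bounded_degree :: "nat \<Rightarrow> 'a set set set" where
  "bounded_degree k = {G. \<forall>x\<in>A \<union> B. card (nbrs G (A \<union> B) x) \<le> k}"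

lemma bounded_degree_mono: "G \<in> bounded_degree k \<Longrightarrow> H \<subseteq> G \<Longrightarrow> H \<in> bounded_degree k"
  unfolding bounded_degree_def
  using card_nbrs_mono[of "A \<union> B" H G "A \<union> B"] finA finB by (auto intro: order_trans)

lemma card_nbrs_le:
  assumes "G \<in> bounded_degree k" "x \<in> A \<union> B" "X \<subseteq> A \<union> B"
  shows "card (nbrs G X x) \<le> k"
proof -
  have "card (nbrs G X x) \<le> card (nbrs G (A \<union> B) x)"
    using assms(3) finA finB by (intro card_nbrs_mono) auto
  also have "\<dots> \<le> k" using assms(1,2) unfolding bounded_degree_def by blast
  finally show ?thesis .
qed

text \<open>
  Switching: to a graph in \<open>F\<close> add paths \<open>v\<close> -- \<open>w\<close> -- \<open>u\<close> for an independent family \<open>T\<close> of unblocked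
  pairs \<open>(u, w)\<close>. The common neighbours of \<open>v\<close> and \<open>U\<close> in the new graph reveal \<open>T\<close>.
\<close>

lemma weight_no_common_neighbour_le:
  fixes l :: real
  assumes v: "v \<in> A" and U: "U \<subseteq> A - {v}" and l: "0 \<le> l"
    and small: "(1 + l\<^sup>2) ^ (card U * (d + 1)) \<le> 2"
    and q: "q + 4 * d * k + (card U + 1) * k \<le> card B"
  defines "F \<equiv> {G\<in>near_bipartite A B d. nbrs G A v = {} \<and>
     (\<forall>u\<in>U. nbrs G B u \<inter> nbrs G B v = {}) \<and> G \<in> bounded_degree k}"
  shows "(1 + l\<^sup>2 / 2) ^ (card U * q) * weight l F \<le> weight l (near_bipartite A B d)"
proof -
  \<comment> \<open>The vertex \<open>w\<close> must avoid the neighbours of every \<open>u'\<close>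
    in \<open>U\<close>, not only of \<open>u\<close>: an old edge \<open>{u', w}\<close> together
    with the new edge \<open>{v, w}\<close> would be a common neighbour not coming from
    \<open>T\<close> and would mislead \<open>\<psi>\<close>.\<close>
  define P where "P G = Sigma U (\<lambda>u. B - (blocked G v \<union> blocked G u \<union> nbrs G B v \<union> (\<Union>u'\<in>U. nbrs G B u')))"
    for G
  \<comment> \<open>Conflicts between pairs. A shared \<open>w\<close> would make the edge
    \<open>{v, w}\<close> serve twice, spoiling the count of two new edges per pair, and could close
    a triangle with an edge inside \<open>U\<close>; adjacent \<open>w\<close> and \<open>w'\<close>
    would form a triangle with \<open>v\<close>.\<close>
  define R where "R G a b \<longleftrightarrow> snd a = snd b \<or> {snd a, snd b} \<in> G" for G and a b :: "'a \<times> 'a"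
  define J where "J G = {T. T \<subseteq> P G \<and> (\<forall>a\<in>T. \<forall>b\<in>T. a \<noteq> b \<longrightarrow> \<not> R G a b)}" for G
  define \<phi> where "\<phi> T = star v (snd ` T) \<union> (\<lambda>(u, w). {u, w}) ` T" for T
  define \<psi> where "\<psi> H = {(u, w). u \<in> U \<and> w \<in> B \<and> {v, w} \<in> H \<and> {u, w} \<in> H}" for H
  have finU: "finite U" using U finA finite_subset by blast
  have vU: "v \<notin> U" "U \<subseteq> A" "v \<notin> B" using U v disj by auto
  have fP: "finite (P G)" for G unfolding P_def using finU finB by auto
  have mem: "{a, b} \<in> \<phi> T \<longleftrightarrow> (a = v \<and> b \<in> snd ` T \<or> b = v \<and> a \<in> snd ` T \<or> (a, b) \<in> T \<or> (b, a) \<in> T)" for a b T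
  proof -
    have "{a, b} \<in> (\<lambda>(u, w). {u, w}) ` T \<longleftrightarrow> (a, b) \<in> T \<or> (b, a) \<in> T"
      by (force simp: doubleton_eq_iff image_iff)
    then show ?thesis unfolding \<phi>_def Un_iff mem_star by blast
  qed
  have PT: "u \<in> U \<and> w \<in> B \<and> w \<notin> blocked G v \<and> w \<notin> blocked G u \<and> {v, w} \<notin> G \<and> (\<forall>u'\<in>U. {u', w} \<notin> G)"
    if "T \<in> J G" "(u, w) \<in> T" for G T u w
  proof -
    have "(u, w) \<in> P G" using that unfolding J_def by blast
    then show ?thesis unfolding P_def nbrs_def by blast
  qed
  have RT: "a = b" if "T \<in> J G" "a \<in> T" "b \<in> T" "R G a b" for G T a b
    using that unfolding J_def by blast
  have disjoint: "G \<inter> \<phi> T = {}" if "T \<in> J G" for G T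
    using PT[OF that] unfolding \<phi>_def star_def by fastforce
  show ?thesis
  proof (rule weight_switching[where J = J and \<phi> = \<phi> and \<psi> = \<psi> and k = 2])
    show "finite F" unfolding F_def using finite_near_bipartite by simp
    show "finite (near_bipartite A B d)" by (rule finite_near_bipartite)
    show "finite (J G)" for G
      unfolding J_def using fP by (auto intro: finite_subset[of _ "Pow (P G)"])
    show "0 \<le> l" by (rule l)
  next
    fix G T assume G: "G \<in> F" and T: "T \<in> J G"
    have Gnb: "G \<in> near_bipartite A B d" and Gv: "\<And>x. x \<in> A \<Longrightarrow> {v, x} \<notin> G"
      using G by (auto simp: F_def nbrs_def)
    have Tw: "\<exists>u. (u, w) \<in> T" if "w \<in> snd ` T" for w using that by force
    show "G \<union> \<phi> T \<in> near_bipartite A B d"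
    proof (rule add_cross_edges[OF Gnb])
      fix e assume "e \<in> \<phi> T"
      then consider w where "w \<in> snd ` T" "e = {v, w}" | u w where "(u, w) \<in> T" "e = {u, w}"
        by (auto simp: \<phi>_def star_def)
      then show "\<exists>a\<in>A. \<exists>w\<in>B. e = {a, w}"
      proof cases
        case 1
        then show ?thesis using Tw PT[OF T] v by blast
      next
        case 2
        then show ?thesis using PT[OF T] vU by blast
      qed
    next
      fix a w x assume "{a, w} \<in> \<phi> T"
      then show "\<not> ({a, x} \<in> G \<and> {x, w} \<in> G)"
        unfolding mem using Tw PT[OF T] by (fastforce simp: blocked_def insert_commute)
    next
      fix x y z assume yz: "y \<noteq> z" "{x, y} \<in> \<phi> T" "{x, z} \<in> \<phi> T"
      have w_unique: "u = u'" if "(u, w) \<in> T" "(u', w) \<in> T" for u u' w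
        using RT[OF T that] by (simp add: R_def)
      have indep: "{w, w'} \<notin> G" if "(u, w) \<in> T" "(u', w') \<in> T" "w \<noteq> w'" for u u' w w'
        using RT[OF T that(1,2)] that(3) by (auto simp: R_def)
      have inA: "u \<in> A \<and> u \<noteq> v \<and> w \<in> B \<and> w \<noteq> v \<and> w \<notin> A" if "(u, w) \<in> T" for u w
        using PT[OF T that] vU disj by auto
      have vw: "{v, u} \<notin> G \<and> {u, v} \<notin> G" if "(u, w) \<in> T" for u w
        using Gv inA[OF that] by (simp add: insert_commute)
      have wB: "w \<in> B \<and> w \<notin> A \<and> w \<noteq> v" if "w \<in> snd ` T" for w
        using Tw[OF that] inA by blast
      have cases: "x = v \<and> b \<in> snd ` T \<or> x \<in> A \<and> x \<noteq> v \<and> (x, b) \<in> T \<or> x \<in> B \<and> (b = v \<or> (b, x) \<in> T)"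
        if "{x, b} \<in> \<phi> T" for b
        using that inA wB unfolding mem by blast
      consider "x = v" | "x \<in> A" "x \<noteq> v" | "x \<in> B" using cases[OF yz(2)] by blast
      then show "{y, z} \<notin> G"
      proof cases
        case 1
        then have "y \<in> snd ` T" "z \<in> snd ` T" using cases[OF yz(2)] cases[OF yz(3)] vU by auto
        then show ?thesis using Tw[of y] Tw[of z] indep yz(1) by blast
      next
        case 2
        then have "(x, y) \<in> T" "(x, z) \<in> T" using cases[OF yz(2)] cases[OF yz(3)] disj by auto
        then show ?thesis using indep yz(1) by blast
      next
        case 3
        then have "y = v \<or> (y, x) \<in> T" "z = v \<or> (z, x) \<in> T"
          using cases[OF yz(2)] cases[OF yz(3)] disj v by auto
        then show ?thesis using w_unique vw yz(1) by blast
      qed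
    qed
    show "card (G \<union> \<phi> T) = card G + 2 * card T"
    proof -
      have TP: "T \<subseteq> P G" using T by (simp add: J_def)
      then have fT: "finite T" using fP finite_subset by blast
      have "inj_on snd T" using RT[OF T] by (auto simp: inj_on_def R_def)
      then have c1: "card (star v (snd ` T)) = card T" by (simp add: card_star card_image)
      have TUB: "u \<in> A \<and> w \<in> B" if "(u, w) \<in> T" for u w using PT[OF T that] vU by blast
      have "inj_on (\<lambda>(u, w). {u, w}) T"
      proof (rule inj_onI, clarify)
        fix u w u' w' assume *: "(u, w) \<in> T" "(u', w') \<in> T" "{u, w} = {u', w'}"
        then show "u = u' \<and> w = w'" using TUB[OF *(1)] TUB[OF *(2)] disj by (auto simp: doubleton_eq_iff)
      qed
      then have c2: "card ((\<lambda>(u, w). {u, w}) ` T) = card T" by (rule card_image)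
      have "star v (snd ` T) \<inter> (\<lambda>(u, w). {u, w}) ` T = {}"
        using PT[OF T] vU by (fastforce simp: star_def doubleton_eq_iff)
      then have "card (\<phi> T) = 2 * card T"
        unfolding \<phi>_def using c1 c2 fT by (subst card_Un_disjoint) (auto simp: finite_star)
      moreover have "finite (\<phi> T)" unfolding \<phi>_def using fT by (simp add: finite_star)
      ultimately show ?thesis
        using disjoint[OF T] near_bipartite_finite[OF Gnb] by (simp add: card_Un_disjoint)
    qed
    show "\<psi> (G \<union> \<phi> T) = T \<and> G \<inter> \<phi> T = {}"
    proof
      show "\<psi> (G \<union> \<phi> T) = T"
      proof (intro set_eqI, clarify)
        fix u w
        have new: "{v, w} \<in> \<phi> T \<longleftrightarrow> w \<in> snd ` T" "{u, w} \<in> \<phi> T \<longleftrightarrow> (u, w) \<in> T" if uw: "u \<in> U" "w \<in> B"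
        proof -
          have "u \<noteq> v" "w \<noteq> v" "u \<notin> B" "(v, w) \<notin> T" "(w, v) \<notin> T" "(w, u) \<notin> T" "v \<notin> snd ` T"
            using uw PT[OF T] Tw vU disj by blast+
          then show "{v, w} \<in> \<phi> T \<longleftrightarrow> w \<in> snd ` T" "{u, w} \<in> \<phi> T \<longleftrightarrow> (u, w) \<in> T"
            unfolding mem by blast+
        qed
        have old: "\<not> ({v, w} \<in> G \<and> {u, w} \<in> G)" if "u \<in> U" "w \<in> B"
          using that G by (auto simp: F_def nbrs_def)
        show "(u, w) \<in> \<psi> (G \<union> \<phi> T) \<longleftrightarrow> (u, w) \<in> T"
        proof
          assume "(u, w) \<in> T"
          then show "(u, w) \<in> \<psi> (G \<union> \<phi> T)"
            using PT[OF T] new by (force simp: \<psi>_def)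
        next
          assume "(u, w) \<in> \<psi> (G \<union> \<phi> T)"
          then have uw: "u \<in> U" "w \<in> B" "{v, w} \<in> G \<or> w \<in> snd ` T" "{u, w} \<in> G \<or> (u, w) \<in> T"
            using new unfolding \<psi>_def by auto
          then show "(u, w) \<in> T" using old Tw PT[OF T] by blast
        qed
      qed
      show "G \<inter> \<phi> T = {}" by (rule disjoint[OF T])
    qed
  next
    fix G assume G: "G \<in> F"
    have Gnb: "G \<in> near_bipartite A B d" and Gb: "G \<in> bounded_degree k" using G by (auto simp: F_def)
    have deg: "card (nbrs G (A \<union> B) x) \<le> k" if "x \<in> A \<union> B" for x
      using Gb that by (simp add: bounded_degree_def)
    have row: "q \<le> card (B - (blocked G v \<union> blocked G u \<union> nbrs G B v \<union> (\<Union>u'\<in>U. nbrs G B u')))" if u: "u \<in> U" for u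
    proof -
      let ?X = "blocked G v \<union> blocked G u \<union> nbrs G B v \<union> (\<Union>u'\<in>U. nbrs G B u')"
      have "card ?X \<le> card (blocked G v \<union> blocked G u \<union> nbrs G B v) + card (\<Union>u'\<in>U. nbrs G B u')"
        by (rule card_Un_le)
      also have "card (blocked G v \<union> blocked G u \<union> nbrs G B v) \<le> card (blocked G v \<union> blocked G u) + card (nbrs G B v)"
        by (rule card_Un_le)
      also have "card (blocked G v \<union> blocked G u) \<le> card (blocked G v) + card (blocked G u)"
        by (rule card_Un_le)
      also have "card (blocked G v) \<le> 2 * d * k" by (rule card_blocked[OF Gnb v deg])
      also have "card (blocked G u) \<le> 2 * d * k" using u vU by (intro card_blocked[OF Gnb _ deg]) auto
      also have "card (nbrs G B v) \<le> k" using v by (intro card_nbrs_le[OF Gb]) auto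
      also have "card (\<Union>u'\<in>U. nbrs G B u') \<le> (\<Sum>u'\<in>U. card (nbrs G B u'))" by (rule card_UN_le[OF finU])
      also have "\<dots> \<le> (\<Sum>u'\<in>U. k)" using vU by (intro sum_mono card_nbrs_le[OF Gb]) auto
      finally have "card ?X \<le> 2 * d * k + 2 * d * k + k + card U * k" by simp
      moreover have "card B - card ?X \<le> card (B - ?X)"
        by (rule diff_card_le_card_Diff, rule finite_subset[OF _ finB]) (auto simp: blocked_def nbrs_def)
      ultimately show ?thesis using q by (simp add: algebra_simps)
    qed
    have "(\<Sum>u\<in>U. q) \<le> card (P G)"
      unfolding P_def by (subst card_SigmaI[OF finU]) (use finB row in \<open>auto intro!: sum_mono simp del: sum_constant\<close>)
    then have cardP: "card U * q \<le> card (P G)" by simp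
    have "card {b\<in>P G. R G a b} \<le> card U * (d + 1)" if a: "a \<in> P G" for a
    proof -
      have "snd a \<in> B" using a by (auto simp: P_def)
      have "{b\<in>P G. R G a b} \<subseteq> U \<times> insert (snd a) (nbrs G B (snd a))"
        by (auto simp: P_def R_def nbrs_def)
      then have "card {b\<in>P G. R G a b} \<le> card (U \<times> insert (snd a) (nbrs G B (snd a)))"
        using finU finB by (intro card_mono) (auto simp: finite_nbrs)
      also have "\<dots> \<le> card U * (card (nbrs G B (snd a)) + 1)"
        unfolding card_cartesian_product by (intro mult_left_mono) (auto simp: card_insert_if finite_nbrs finB)
      also have "\<dots> \<le> card U * (d + 1)"
        using Gnb \<open>snd a \<in> B\<close> by (intro mult_left_mono) (auto simp: near_bipartite_def)
      finally show ?thesis .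
    qed
    then have "(1 + l\<^sup>2 / 2) ^ card (P G) \<le> (\<Sum>T | T \<subseteq> P G \<and> (\<forall>a\<in>T. \<forall>b\<in>T. a \<noteq> b \<longrightarrow> \<not> R G a b). (l\<^sup>2) ^ card T)"
      using fP small by (intro independent_sets_weight_ge) (auto simp: R_def insert_commute)
    moreover have "(1 + l\<^sup>2 / 2) ^ (card U * q) \<le> (1 + l\<^sup>2 / 2) ^ card (P G)"
      using cardP by (intro power_increasing) auto
    ultimately show "(1 + l\<^sup>2 / 2) ^ (card U * q) \<le> (\<Sum>T\<in>J G. (l\<^sup>2) ^ card T)"
      by (simp add: J_def)
  qed
qed

text \<open>The switching with single edges: attach to \<open>a\<close> an independent set of
  unblocked vertices of \<open>B\<close>. Since \<open>a\<close> had no neighbours in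
  \<open>B\<close> before, its new neighbourhood reveals the set; conflicts are edges inside
  \<open>B\<close>, hence at most \<open>d\<close> per vertex.\<close>

lemma weight_no_cross_neighbour_le:
  fixes l :: real
  assumes a: "a \<in> A" and l: "0 \<le> l" and small: "(1 + l) ^ d \<le> 2" and q: "q + 2 * d * k \<le> card B"
  defines "F \<equiv> {G\<in>near_bipartite A B d. nbrs G B a = {} \<and> G \<in> bounded_degree k}"
  shows "(1 + l / 2) ^ q * weight l F \<le> weight l (near_bipartite A B d)"
proof -
  define J where "J G = {T. T \<subseteq> B - blocked G a \<and> (\<forall>x\<in>T. \<forall>y\<in>T. x \<noteq> y \<longrightarrow> {x, y} \<notin> G)}" for G
  have aB: "a \<notin> B" using a disj by blast
  have disjoint: "G \<inter> star a T = {}" if "G \<in> F" "T \<in> J G" for G T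
    using that by (auto simp: F_def J_def nbrs_def star_def)
  show ?thesis
  proof (rule weight_switching[where J = J and \<phi> = "star a" and \<psi> = "\<lambda>H. nbrs H B a" and k = 1])
    show "finite F" unfolding F_def using finite_near_bipartite by simp
    show "finite (near_bipartite A B d)" by (rule finite_near_bipartite)
    show "finite (J G)" for G
      unfolding J_def using finB by (auto intro: finite_subset[of _ "Pow B"])
    show "0 \<le> l" by (rule l)
  next
    fix G T assume G: "G \<in> F" and T: "T \<in> J G"
    have Gnb: "G \<in> near_bipartite A B d" using G by (auto simp: F_def)
    have TB: "T \<subseteq> B" using T by (auto simp: J_def)
    show "G \<union> star a T \<in> near_bipartite A B d"
    proof (rule add_cross_edges[OF Gnb])
      show "\<exists>a\<in>A. \<exists>w\<in>B. e = {a, w}" if "e \<in> star a T" for e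
        using that TB a by (auto simp: star_def)
      have free: "\<not> ({a, x} \<in> G \<and> {x, w} \<in> G)" if "w \<in> T" for w x
        using that T by (auto simp: J_def blocked_def)
      show "\<not> ({b, x} \<in> G \<and> {x, w} \<in> G)" if "{b, w} \<in> star a T" for b w x
        using that free unfolding mem_star by (metis insert_commute)
      show "{y, z} \<notin> G" if "y \<noteq> z" "{x, y} \<in> star a T" "{x, z} \<in> star a T" for x y z
        using that T TB aB unfolding mem_star by (auto simp: J_def)
    qed
    have "finite T" using TB finB finite_subset by blast
    then show "card (G \<union> star a T) = card G + 1 * card T"
      using disjoint[OF G T] near_bipartite_finite[OF Gnb] by (simp add: card_Un_disjoint finite_star card_star)
    show "nbrs (G \<union> star a T) B a = T \<and> G \<inter> star a T = {}"
      using disjoint[OF G T] G TB aB by (auto simp: nbrs_def F_def mem_star)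
  next
    fix G assume G: "G \<in> F"
    have Gnb: "G \<in> near_bipartite A B d" and Gb: "G \<in> bounded_degree k" using G by (auto simp: F_def)
    have "card (blocked G a) \<le> 2 * d * k"
      using Gb by (intro card_blocked[OF Gnb a]) (simp add: bounded_degree_def)
    moreover have "card B - card (blocked G a) \<le> card (B - blocked G a)"
      by (rule diff_card_le_card_Diff, rule finite_subset[OF _ finB]) (auto simp: blocked_def)
    ultimately have cardP: "q \<le> card (B - blocked G a)" using q by simp
    have "card {b \<in> B - blocked G a. {x, b} \<in> G} \<le> d" if "x \<in> B - blocked G a" for x
    proof -
      have "card {b \<in> B - blocked G a. {x, b} \<in> G} \<le> card (nbrs G B x)"
        using finB by (intro card_mono) (auto simp: nbrs_def)
      also have "\<dots> \<le> d" using Gnb that by (auto simp: near_bipartite_def)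
      finally show ?thesis .
    qed
    then have "(1 + l / 2) ^ card (B - blocked G a) \<le> (\<Sum>T | T \<subseteq> B - blocked G a \<and> (\<forall>x\<in>T. \<forall>y\<in>T. x \<noteq> y \<longrightarrow> {x, y} \<notin> G). l ^ card T)"
      using finB small l by (intro independent_sets_weight_ge) (auto simp: insert_commute)
    moreover have "(1 + l / 2) ^ q \<le> (1 + l / 2) ^ card (B - blocked G a)"
      using cardP l by (intro power_increasing) auto
    ultimately show "(1 + l / 2) ^ q \<le> (\<Sum>T\<in>J G. (l ^ 1) ^ card T)"
      by (simp add: J_def)
  qed
qed

section \<open>Union bounds over neighbourhoods\<close>

lemma weight_star_le:
  assumes l: "0 \<le> l"
    and F: "\<And>G. G \<in> F \<Longrightarrow> G \<in> near_bipartite A B d \<and> star v U \<subseteq> G \<and> G - star v U \<in> F'"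
    and F': "F' \<subseteq> near_bipartite A B d"
  shows "weight l F \<le> l ^ card U * weight l F'"
  unfolding card_star[symmetric, of U v]
proof (rule weight_remove_le)
  show "finite F" by (rule finite_subset[OF _ finite_near_bipartite]) (use F in auto)
  show "finite F'" by (rule finite_subset[OF F' finite_near_bipartite])
qed (use l F near_bipartite_finite in auto)

text \<open>A first-moment bound: pick \<open>k\<close> of the neighbours and delete their star.
  Since the class is closed under deletion, each choice costs \<open>l ^ k\<close>.\<close>

lemma weight_large_degree_le:
  fixes l :: real
  assumes l: "0 \<le> l"
  shows "weight l {G\<in>near_bipartite A B d. k \<le> card (nbrs G (A \<union> B) v)}
    \<le> real (card (A \<union> B) choose k) * l ^ k * weight l (near_bipartite A B d)"
proof -
  let ?S = "near_bipartite A B d" and ?V = "A \<union> B"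
  let ?I = "{U. U \<subseteq> ?V \<and> card U = k}" and ?F = "\<lambda>U. {G\<in>?S. star v U \<subseteq> G}"
  have fI: "finite ?I" using finA finB by (auto intro: finite_subset[of _ "Pow ?V"])
  have cover: "{G\<in>?S. k \<le> card (nbrs G ?V v)} \<subseteq> (\<Union>U\<in>?I. ?F U)"
  proof
    fix G assume G: "G \<in> {G\<in>?S. k \<le> card (nbrs G ?V v)}"
    then obtain U where U: "U \<subseteq> nbrs G ?V v" "card U = k"
      by (metis (mono_tags, lifting) mem_Collect_eq obtain_subset_with_card_n)
    then have "U \<in> ?I" "star v U \<subseteq> G" by (auto simp: nbrs_def star_def)
    then show "G \<in> (\<Union>U\<in>?I. ?F U)" using G by blast
  qed
  have "weight l {G\<in>?S. k \<le> card (nbrs G ?V v)} \<le> weight l (\<Union>U\<in>?I. ?F U)"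
    using cover fI finite_near_bipartite l by (intro weight_mono) auto
  also have "\<dots> \<le> (\<Sum>U\<in>?I. weight l (?F U))"
    using fI finite_near_bipartite l by (intro weight_UN_le) auto
  also have "\<dots> \<le> (\<Sum>U\<in>?I. l ^ k * weight l ?S)"
  proof (rule sum_mono)
    fix U assume "U \<in> ?I"
    then have "weight l (?F U) \<le> l ^ card U * weight l ?S" "card U = k"
      by (auto intro!: weight_star_le l near_bipartite_mono[of _ "_ - _"])
    then show "weight l (?F U) \<le> l ^ k * weight l ?S" by simp
  qed
  also have "\<dots> = real (card ?V choose k) * l ^ k * weight l ?S"
    using n_subsets[of ?V k] finA finB by simp
  finally show ?thesis .
qed

text \<open>Fix the neighbourhood \<open>U\<close> of \<open>v\<close> inside \<open>A\<close> and
  delete its star at the price \<open>l ^ d\<close>. The remaining graph still has no common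
  neighbour of \<open>v\<close> and \<open>U\<close>, which the path switching shows to be rare; the
  binomial coefficient counts the choices of \<open>U\<close>.\<close>

lemma weight_full_defect_le:
  fixes l :: real
  assumes v: "v \<in> A" and l: "0 \<le> l" and small: "(1 + l\<^sup>2) ^ (d * (d + 1)) \<le> 2"
    and q: "q + 4 * d * k + (d + 1) * k \<le> card B"
  shows "weight l {G\<in>near_bipartite A B d. card (nbrs G A v) = d \<and> G \<in> bounded_degree k} * (1 + l\<^sup>2 / 2) ^ (d * q)
    \<le> real (card A choose d) * l ^ d * weight l (near_bipartite A B d)"
proof -
  let ?S = "near_bipartite A B d"
  let ?I = "{U. U \<subseteq> A \<and> card U = d}"
  let ?F = "\<lambda>U. {G\<in>?S. nbrs G A v = U \<and> G \<in> bounded_degree k}"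
  let ?c = "(1 + l\<^sup>2 / 2) ^ (d * q)"
  have fI: "finite ?I" using finA by (auto intro: finite_subset[of _ "Pow A"])
  have "weight l {G\<in>?S. card (nbrs G A v) = d \<and> G \<in> bounded_degree k} \<le> weight l (\<Union>U\<in>?I. ?F U)"
    using fI finite_near_bipartite l by (intro weight_mono) (auto simp: nbrs_subset)
  also have "\<dots> \<le> (\<Sum>U\<in>?I. weight l (?F U))"
    using fI finite_near_bipartite l by (intro weight_UN_le) auto
  finally have "weight l {G\<in>?S. card (nbrs G A v) = d \<and> G \<in> bounded_degree k} * ?c
      \<le> (\<Sum>U\<in>?I. weight l (?F U)) * ?c"
    by (intro mult_right_mono) auto
  also have "\<dots> = (\<Sum>U\<in>?I. weight l (?F U) * ?c)" by (rule sum_distrib_right)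
  also have "\<dots> \<le> (\<Sum>U\<in>?I. l ^ d * weight l ?S)"
  proof (rule sum_mono)
    fix U assume U: "U \<in> ?I"
    show "weight l (?F U) * ?c \<le> l ^ d * weight l ?S"
    proof (cases "v \<in> U")
      case True
      then have "?F U = {}" using near_bipartite_edge[of _ v v] by (force simp: nbrs_def)
      then have "weight l (?F U) = 0" by (simp only: weight_def sum.empty)
      then show ?thesis using l weight_nonneg[of l ?S] by simp
    next
      case False
      let ?F' = "{G\<in>?S. nbrs G A v = {} \<and> (\<forall>u\<in>U. nbrs G B u \<inter> nbrs G B v = {}) \<and> G \<in> bounded_degree k}"
      have "weight l (?F U) \<le> l ^ card U * weight l ?F'"
      proof (rule weight_star_le[OF l])
        fix G assume G: "G \<in> ?F U"
        then have GS: "G \<in> ?S" and GU: "nbrs G A v = U" and Gb: "G \<in> bounded_degree k" by auto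
        have sub: "G - star v U \<subseteq> G" by blast
        have "nbrs (G - star v U) A v = {}" using GU by (auto simp: nbrs_def star_def)
        \<comment> \<open>The deleted edges did their work beforehand: a common neighbour
          \<open>w\<close> of \<open>u\<close> and \<open>v\<close> would have completed a triangle
          in \<open>G\<close>.\<close>
        moreover have "nbrs (G - star v U) B u \<inter> nbrs (G - star v U) B v = {}" if u: "u \<in> U" for u
        proof (rule ccontr)
          assume "nbrs (G - star v U) B u \<inter> nbrs (G - star v U) B v \<noteq> {}"
          then obtain w where w: "{u, w} \<in> G" "{v, w} \<in> G" "{v, u} \<in> G"
            using u GU by (auto simp: nbrs_def)
          moreover have "u \<noteq> v" "u \<noteq> w" "v \<noteq> w"
            using near_bipartite_edge[OF GS w(1)] near_bipartite_edge[OF GS w(2)]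
              near_bipartite_edge[OF GS w(3)] by simp_all
          moreover have "triangle_free G" using GS by (simp add: near_bipartite_def)
          ultimately show False unfolding triangle_free_def by metis
        qed
        moreover have "star v U \<subseteq> G" using GU by (auto simp: nbrs_def star_def)
        ultimately show "G \<in> ?S \<and> star v U \<subseteq> G \<and> G - star v U \<in> ?F'"
          using GS near_bipartite_mono[OF GS sub] bounded_degree_mono[OF Gb sub] by blast
      qed blast
      then have "weight l (?F U) * ?c \<le> (l ^ d * weight l ?F') * ?c"
        using U by (intro mult_right_mono) auto
      also have "\<dots> = l ^ d * (?c * weight l ?F')" by simp
      also have "\<dots> \<le> l ^ d * weight l ?S"
        using weight_no_common_neighbour_le[OF v, of U l q k] U False l small q
        by (intro mult_left_mono) auto
      finally show ?thesis .
    qed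
  qed
  also have "\<dots> = real (card A choose d) * l ^ d * weight l ?S"
    using n_subsets[OF finA, of d] by simp
  finally show ?thesis .
qed

text \<open>The same two moves for cross edges: delete the few edges from \<open>a\<close> to
  \<open>B\<close>, then gain by attaching many. Small neighbourhoods of every size up to
  \<open>d\<close> occur, hence the partial binomial sum.\<close>

lemma weight_few_cross_neighbours_le:
  fixes l :: real
  assumes a: "a \<in> A" and l: "0 \<le> l" and small: "(1 + l) ^ d \<le> 2" and q: "q + 2 * d * k \<le> card B"
  shows "weight l {G\<in>near_bipartite A B d. card (nbrs G B a) \<le> d \<and> G \<in> bounded_degree k} * (1 + l / 2) ^ q
    \<le> (\<Sum>j\<le>d. real (card B choose j) * l ^ j) * weight l (near_bipartite A B d)"
proof -
  let ?S = "near_bipartite A B d"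
  let ?I = "{Y. Y \<subseteq> B \<and> card Y \<le> d}"
  let ?F = "\<lambda>Y. {G\<in>?S. nbrs G B a = Y \<and> G \<in> bounded_degree k}"
  let ?c = "(1 + l / 2) ^ q"
  have fI: "finite ?I" using finB by (auto intro: finite_subset[of _ "Pow B"])
  have "weight l {G\<in>?S. card (nbrs G B a) \<le> d \<and> G \<in> bounded_degree k} \<le> weight l (\<Union>Y\<in>?I. ?F Y)"
    using fI finite_near_bipartite l by (intro weight_mono) (auto simp: nbrs_subset)
  also have "\<dots> \<le> (\<Sum>Y\<in>?I. weight l (?F Y))"
    using fI finite_near_bipartite l by (intro weight_UN_le) auto
  finally have "weight l {G\<in>?S. card (nbrs G B a) \<le> d \<and> G \<in> bounded_degree k} * ?c
      \<le> (\<Sum>Y\<in>?I. weight l (?F Y)) * ?c"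
    using l by (intro mult_right_mono) auto
  also have "\<dots> = (\<Sum>Y\<in>?I. weight l (?F Y) * ?c)" by (rule sum_distrib_right)
  also have "\<dots> \<le> (\<Sum>Y\<in>?I. l ^ card Y * weight l ?S)"
  proof (rule sum_mono)
    fix Y assume Y: "Y \<in> ?I"
    let ?F' = "{G\<in>?S. nbrs G B a = {} \<and> G \<in> bounded_degree k}"
    have "weight l (?F Y) \<le> l ^ card Y * weight l ?F'"
    proof (rule weight_star_le[OF l])
      fix G assume G: "G \<in> ?F Y"
      then have GS: "G \<in> ?S" and GY: "nbrs G B a = Y" and Gb: "G \<in> bounded_degree k" by auto
      have sub: "G - star a Y \<subseteq> G" by blast
      have "nbrs (G - star a Y) B a = {}" "star a Y \<subseteq> G" using GY by (auto simp: nbrs_def star_def)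
      then show "G \<in> ?S \<and> star a Y \<subseteq> G \<and> G - star a Y \<in> ?F'"
        using GS near_bipartite_mono[OF GS sub] bounded_degree_mono[OF Gb sub] by blast
    qed blast
    then have "weight l (?F Y) * ?c \<le> (l ^ card Y * weight l ?F') * ?c"
      using l by (intro mult_right_mono) auto
    also have "\<dots> = l ^ card Y * (?c * weight l ?F')" by simp
    also have "\<dots> \<le> l ^ card Y * weight l ?S"
      using weight_no_cross_neighbour_le[OF a l small q] l by (intro mult_left_mono) auto
    finally show "weight l (?F Y) * ?c \<le> l ^ card Y * weight l ?S" .
  qed
  also have "\<dots> = (\<Sum>j\<le>d. real (card B choose j) * l ^ j) * weight l ?S"
  proof -
    have "?I = (\<Union>j\<in>{..d}. {Y. Y \<subseteq> B \<and> card Y = j})" by auto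
    then have "(\<Sum>Y\<in>?I. l ^ card Y) = (\<Sum>j\<le>d. \<Sum>Y | Y \<subseteq> B \<and> card Y = j. l ^ card Y)"
      using finB by (simp only:, subst sum.UNION_disjoint)
        (auto intro: finite_subset[of _ "Pow B"])
    also have "\<dots> = (\<Sum>j\<le>d. real (card B choose j) * l ^ j)"
      by (intro sum.cong refl) (simp add: n_subsets[OF finB])
    finally show ?thesis by (simp add: sum_distrib_right[symmetric])
  qed
  finally show ?thesis .
qed

end

section \<open>Sparse edge probabilities\<close>

text \<open>A Chernoff bound: the term is tilted by \<open>\<theta>\<close> and bounded by the whole
  binomial expansion of \<open>(1 + \<theta> * l) ^ N\<close>. A large \<open>\<theta>\<close> suits
  upper tails, a small one lower tails or sets much smaller than \<open>l * N\<close>.\<close>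

lemma choose_power_le:
  fixes l \<theta> :: real
  assumes "0 \<le> l" "0 < \<theta>"
  shows "real (N choose k) * l ^ k \<le> (1 / \<theta>) ^ k * exp (\<theta> * l * N)"
proof -
  have "real (N choose k) * (\<theta> * l) ^ k \<le> (\<Sum>j\<le>N. real (N choose j) * (\<theta> * l) ^ j)"
  proof (cases "k \<le> N")
    case True
    then show ?thesis using assms by (intro member_le_sum) auto
  next
    case False
    then show ?thesis using assms by (simp add: binomial_eq_0 sum_nonneg)
  qed
  also have "\<dots> = (1 + \<theta> * l) ^ N"
    using binomial_ring[of "\<theta> * l" 1 N] by (simp add: add.commute)
  also have "\<dots> \<le> exp (\<theta> * l) ^ N"
    using assms by (intro power_mono exp_ge_add_one_self) auto
  also have "\<dots> = exp (\<theta> * l * N)" by (simp add: exp_of_nat_mult mult.commute)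
  finally show ?thesis using assms by (simp add: power_mult_distrib power_one_over field_simps)
qed

text \<open>The lower-tail version; \<open>\<theta> \<le> 1\<close> lets the single factor
  \<open>\<theta> ^ d\<close> be replaced by \<open>\<theta> ^ j\<close> for every
  \<open>j \<le> d\<close>.\<close>

lemma sum_choose_power_le:
  fixes l \<theta> :: real
  assumes "0 \<le> l" "0 < \<theta>" "\<theta> \<le> 1"
  shows "(\<Sum>j\<le>d. real (N choose j) * l ^ j) \<le> (1 / \<theta>) ^ d * exp (\<theta> * l * N)"
proof -
  have "(\<Sum>j\<le>d. real (N choose j) * l ^ j) * \<theta> ^ d = (\<Sum>j\<le>d. real (N choose j) * l ^ j * \<theta> ^ d)"
    by (rule sum_distrib_right)
  also have "\<dots> \<le> (\<Sum>j\<le>d. real (N choose j) * (\<theta> * l) ^ j)"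
    unfolding power_mult_distrib using assms
    by (intro sum_mono) (auto simp: mult_ac intro!: mult_right_mono power_decreasing)
  also have "\<dots> \<le> (\<Sum>j\<le>max d N. real (N choose j) * (\<theta> * l) ^ j)"
    using assms by (intro sum_mono2) auto
  also have "\<dots> = (\<Sum>j\<le>N. real (N choose j) * (\<theta> * l) ^ j)"
    by (rule sum.mono_neutral_right) auto
  also have "\<dots> = (1 + \<theta> * l) ^ N"
    using binomial_ring[of "\<theta> * l" 1 N] by (simp add: add.commute)
  also have "\<dots> \<le> exp (\<theta> * l) ^ N"
    using assms by (intro power_mono exp_ge_add_one_self) auto
  also have "\<dots> = exp (\<theta> * l * N)" by (simp add: exp_of_nat_mult mult.commute)
  finally show ?thesis using assms by (simp add: power_one_over field_simps)
qed

lemma exp_half_le: "0 \<le> x \<Longrightarrow> x \<le> 1 \<Longrightarrow> exp (x / 2) \<le> 1 + (x :: real)"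
  using exp_bound[of "x / 2"] mult_right_mono[of x 1 x] by (simp add: power2_eq_square)

lemma power_le_exp: "0 \<le> 1 + x \<Longrightarrow> (1 + x) ^ n \<le> exp (real n * (x :: real))"
  using power_mono[OF exp_ge_add_one_self, of x n] by (simp add: exp_of_nat_mult)

lemma exp_le_power: "0 \<le> x \<Longrightarrow> x \<le> 1 \<Longrightarrow> exp (real n * (x / 2)) \<le> (1 + x :: real) ^ n"
  unfolding exp_of_nat_mult by (intro power_mono exp_half_le) auto

lemma power_two_le_exp: "x \<le> 2 ^ j \<Longrightarrow> 0 \<le> x \<Longrightarrow> (x::real) ^ d \<le> exp (real j * real d)"
proof -
  assume x: "x \<le> 2 ^ j" "0 \<le> x"
  have "(2::real) ^ j \<le> exp 1 ^ j"
    using exp_ge_add_one_self[of 1] by (intro power_mono) auto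
  then have "x \<le> exp (real j)" using x by (simp add: exp_of_nat_mult[symmetric])
  then have "x ^ d \<le> exp (real j) ^ d" using x by (intro power_mono) auto
  then show ?thesis by (simp add: exp_of_nat_mult[symmetric] mult.commute)
qed

lemma exp_le_two: "(x::real) \<le> 1 / 2 \<Longrightarrow> exp x \<le> 2"
  using ln2_ge_two_thirds exp_le_cancel_iff[of x "ln 2"] by simp

lemma double_le_exp_sqrt: "2 * real n \<le> exp (2 * sqrt n)"
proof -
  have "1 + 2 * sqrt n + 2 * real n \<le> exp (2 * sqrt n)"
    using exp_lower_Taylor_quadratic[of "2 * sqrt n"] by (simp add: power_mult_distrib)
  moreover have "0 \<le> sqrt n" by simp
  ultimately show ?thesis by linarith
qed

text \<open>The upper bound on \<open>d\<close> keeps the unusable vertices below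
  \<open>3 / 20 * n\<close> and the number of conflicts harmless; the lower bound turns the gain
  \<open>p\<^sup>2 * n * d\<close> into a multiple of \<open>p * n\<close>. The window of ratio two
  leaves room for rounding \<open>d\<close> to an integer.\<close>

locale sparse_bipartition = bipartition +
  fixes n :: nat and p :: real
  assumes n: "card (A \<union> B) = n"
    and cardA: "2 / 5 * real n \<le> real (card A)" and cardB: "2 / 5 * real n \<le> real (card B)"
    and p_lower: "400000 \<le> p * sqrt n" and p_upper: "p \<le> 1 / 5000"
    and d_lower: "1 / (2000 * p) \<le> real d" and d_upper: "real d \<le> 1 / (1000 * p)"
begin

abbreviation "S \<equiv> near_bipartite A B d"
definition l :: real where "l = p / (1 - p)"
text \<open>Since \<open>l \<le> 2 * p\<close>, degrees have mean of order at most
  \<open>2 * p * n\<close>; the factor 16 makes exceeding \<open>k\<close> exponentially unlikely in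
  \<open>p * n\<close>, while \<open>d * k\<close> is still a small fraction of
  \<open>n\<close>.\<close>

definition k :: nat where "k = nat \<lceil>16 * p * n\<rceil>"

lemma p_pos: "0 < p"
  using p_lower by (smt (verit) mult_nonpos_nonneg real_sqrt_ge_zero of_nat_0_le_iff)

lemma p2n: "160000000000 \<le> p\<^sup>2 * n"
  using power_mono[OF p_lower, of 2] by (simp add: power_mult_distrib)

lemma pn: "400000 * sqrt n \<le> p * n"
  using mult_right_mono[OF p_lower, of "sqrt n"] by (simp add: mult.assoc)

text \<open>The two bounds on \<open>p\<close> force \<open>n\<close> to be large:
  \<open>2000000000\<close> is the product of 400000 and 5000.\<close>

lemma sqrt_n: "2000000000 \<le> sqrt n"
  using p_lower mult_right_mono[OF p_upper, of "sqrt n"] by simp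

lemma l_bounds: "p \<le> l" "l \<le> 2 * p" "0 \<le> l"
proof -
  have "p * (1 - p) \<le> p * 1" using p_pos by (intro mult_left_mono) auto
  then show "p \<le> l" using p_upper by (simp add: l_def le_divide_eq)
  have "p * 1 \<le> p * (2 * (1 - p))" using p_pos p_upper by (intro mult_left_mono) auto
  then show "l \<le> 2 * p" using p_upper by (simp add: l_def divide_le_eq mult_ac)
  show "0 \<le> l" using p_pos p_upper by (simp add: l_def)
qed

lemma k_bounds: "16 * p * n \<le> real k" "real k \<le> 17 * p * n"
proof -
  show "16 * p * n \<le> real k" unfolding k_def by (rule real_nat_ceiling_ge)
  have "0 \<le> 16 * p * n" using p_pos by simp
  then have "real k \<le> 16 * p * n + 1" unfolding k_def by linarith
  also have "1 \<le> p * n" using pn sqrt_n by linarith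
  finally show "real k \<le> 17 * p * n" by simp
qed

lemma inverse_p: "1 / p \<le> p * n / 160000000000"
  using p2n p_pos by (simp add: field_simps power2_eq_square)

lemma dk: "real d * real k \<le> 17 / 1000 * n"
proof -
  have "real d * real k \<le> 1 / (1000 * p) * (17 * p * n)"
    using d_upper k_bounds p_pos by (intro mult_mono) auto
  then show ?thesis using p_pos by simp
qed

lemma k_small: "real k \<le> 17 / 5000 * n"
  using k_bounds(2) mult_right_mono[OF p_upper, of "17 * real n"] by simp

text \<open>Pays for the union bounds: \<open>n\<close> from the choice of the vertex with full
  defect and another \<open>n\<close> from the graphs of large degree.\<close>

lemma exp_sqrt: "2 * real n * exp (- 3 * sqrt n) \<le> exp (- sqrt n)"
proof -
  have "2 * real n * exp (- 3 * sqrt n) \<le> exp (2 * sqrt n) * exp (- 3 * sqrt n)"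
    by (intro mult_right_mono double_le_exp_sqrt) auto
  then show ?thesis by (simp add: exp_add[symmetric])
qed

lemma exp_pn: "exp (- (14 * p * n)) \<le> exp (- 3 * sqrt n)"
proof -
  have "3 * sqrt n \<le> 14 * (p * n)" using pn sqrt_n by linarith
  then show ?thesis by (simp add: mult.assoc)
qed

lemma weight_unbounded_degree_le:
  "weight l (S - bounded_degree k) \<le> n * exp (- (14 * p * n)) * weight l S"
proof -
  let ?V = "A \<union> B"
  let ?F = "\<lambda>v. {G\<in>S. k + 1 \<le> card (nbrs G ?V v)}"
  have "S - bounded_degree k \<subseteq> (\<Union>v\<in>?V. ?F v)"
    by (auto simp: bounded_degree_def not_le)
  then have "weight l (S - bounded_degree k) \<le> weight l (\<Union>v\<in>?V. ?F v)"
    using finA finB finite_near_bipartite l_bounds(3) by (intro weight_mono) auto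
  also have "\<dots> \<le> (\<Sum>v\<in>?V. weight l (?F v))"
    using finA finB finite_near_bipartite l_bounds(3) by (intro weight_UN_le) auto
  also have "\<dots> \<le> (\<Sum>v\<in>?V. exp (- (14 * p * n)) * weight l S)"
  proof (rule sum_mono)
    fix v
    \<comment> \<open>The tilt 9 is a convenient bound for \<open>exp 2\<close>. With
      \<open>k \<ge> 16 * p * n\<close> the exponent is at most
      \<open>- 32 * p * n + 18 * p * n\<close>.\<close>
    have "real (n choose (k + 1)) * l ^ (k + 1) \<le> (1 / 9) ^ (k + 1) * exp (9 * l * n)"
      by (rule choose_power_le) (use l_bounds in auto)
    also have "\<dots> \<le> exp (- 2) ^ (k + 1) * exp (18 * p * n)"
    proof (intro mult_mono power_mono)
      have "exp (2::real) = exp 1 * exp 1" by (simp add: exp_add[symmetric])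
      also have "\<dots> \<le> 3 * 3" using exp_le by (intro mult_mono) auto
      finally show "1 / 9 \<le> exp (- 2 :: real)" by (simp add: exp_minus field_simps)
      show "exp (9 * l * n) \<le> exp (18 * p * n)"
        using mult_right_mono[OF l_bounds(2), of "9 * real n"] by (simp add: mult_ac)
    qed auto
    also have "\<dots> = exp (real (k + 1) * - 2 + 18 * p * n)"
      by (simp only: exp_of_nat_mult exp_add)
    also have "\<dots> \<le> exp (- (14 * p * n))" using k_bounds(1) by simp
    finally have "real (n choose (k + 1)) * l ^ (k + 1) \<le> exp (- (14 * p * n))" .
    then have "real (n choose (k + 1)) * l ^ (k + 1) * weight l S \<le> exp (- (14 * p * n)) * weight l S"
      by (intro mult_right_mono weight_nonneg l_bounds)
    then show "weight l (?F v) \<le> exp (- (14 * p * n)) * weight l S"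
      using weight_large_degree_le[OF l_bounds(3), of "k + 1" v] n by simp
  qed
  also have "\<dots> = n * exp (- (14 * p * n)) * weight l S" using n by simp
  finally show ?thesis .
qed

lemma weight_full_defect_le_exp:
  assumes v: "v \<in> A"
  shows "weight l {G\<in>S. card (nbrs G A v) = d \<and> G \<in> bounded_degree k} \<le> exp (- 3 * sqrt n) * weight l S"
proof -
  define q where "q = card B - (4 * d * k + (d + 1) * k)"
  have "real (4 * d * k + (d + 1) * k) = 5 * (real d * real k) + real k" by (simp add: algebra_simps)
  then have *: "real (4 * d * k + (d + 1) * k) \<le> 3 / 20 * n" using dk k_small by simp
  then have "real (4 * d * k + (d + 1) * k) \<le> real (card B)" using cardB by linarith
  then have le: "4 * d * k + (d + 1) * k \<le> card B" by (simp only: of_nat_le_iff)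
  then have "real q = real (card B) - real (4 * d * k + (d + 1) * k)" by (simp only: q_def of_nat_diff)
  then have q: "q + 4 * d * k + (d + 1) * k \<le> card B" "n / 4 \<le> real q"
    using le * cardB unfolding q_def by linarith+
  have "1 \<le> 1 / (2000 * p)" using p_upper p_pos by (simp add: le_divide_eq)
  then have d1: "1 \<le> real d" using d_lower by linarith
  have pd: "p * real d \<le> 1 / 1000" "1 / 2000 \<le> p * real d"
    using d_upper d_lower p_pos by (simp_all add: field_simps)
  have l2: "p\<^sup>2 \<le> l\<^sup>2" "l\<^sup>2 \<le> 4 * p\<^sup>2" "l\<^sup>2 \<le> 1"
  proof -
    show "p\<^sup>2 \<le> l\<^sup>2" using l_bounds p_pos by (intro power_mono) auto
    show le: "l\<^sup>2 \<le> 4 * p\<^sup>2" using power_mono[OF l_bounds(2,3), of 2] by (simp add: power_mult_distrib)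
    have "p\<^sup>2 \<le> (1 / 5000)\<^sup>2" using p_upper p_pos by (intro power_mono) auto
    then show "l\<^sup>2 \<le> 1" using le by (simp add: power2_eq_square)
  qed
  have small: "(1 + l\<^sup>2) ^ (d * (d + 1)) \<le> 2"
  proof -
    have "real (d * (d + 1)) * l\<^sup>2 \<le> (2 * (real d)\<^sup>2) * (4 * p\<^sup>2)"
      using d1 l2 by (intro mult_mono) (auto simp: power2_eq_square distrib_left)
    also have "\<dots> = 8 * (p * real d)\<^sup>2" by (simp add: power_mult_distrib)
    also have "\<dots> \<le> 8 * (1 / 1000)\<^sup>2" using pd p_pos by (intro mult_left_mono power_mono) auto
    finally have "exp (real (d * (d + 1)) * l\<^sup>2) \<le> 2" by (intro exp_le_two) (simp add: power2_eq_square)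
    then show ?thesis using power_le_exp[of "l\<^sup>2" "d * (d + 1)"] by simp
  qed
  have x: "17 * real d \<le> p\<^sup>2 * n * d / 64" 
    using mult_right_mono[OF p2n, of "real d"] d1 by simp
  have "exp (p\<^sup>2 * n * d / 16) \<le> exp (real (d * q) * (l\<^sup>2 / 2 / 2))"
  proof -
    have "p\<^sup>2 * n * d / 16 = real d * (n / 4) * (p\<^sup>2 / 4)" by simp
    also have "\<dots> \<le> real d * real q * (l\<^sup>2 / 4)" using q l2 by (intro mult_mono) auto
    finally show ?thesis by simp
  qed
  also have "\<dots> \<le> (1 + l\<^sup>2 / 2) ^ (d * q)" using l2 by (intro exp_le_power) auto
  finally have gain: "exp (p\<^sup>2 * n * d / 16) \<le> (1 + l\<^sup>2 / 2) ^ (d * q)" .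
  \<comment> \<open>The tilt is chosen so that \<open>2 * \<theta> = 1 / (32 * 2000)\<close>: by
    \<open>p * d \<ge> 1 / 2000\<close> the exponential factor then costs at most half of the gain
    \<open>p\<^sup>2 * n * d / 16\<close>. As \<open>128000 \<le> 2 ^ 17\<close>, the power costs
    \<open>17 * d\<close>.\<close>
  have "real (card A choose d) * l ^ d \<le> (1 / (1 / 128000)) ^ d * exp (1 / 128000 * l * card A)"
    by (rule choose_power_le) (use l_bounds in auto)
  also have "\<dots> \<le> exp (real 17 * real d) * exp (p\<^sup>2 * n * d / 32)"
  proof (intro mult_mono)
    show "(1 / (1 / 128000)) ^ d \<le> exp (real 17 * real d)" by (rule power_two_le_exp) auto
    have "card A \<le> n" using n finA finB by (metis card_mono finite_Un sup_ge1)
    then have "1 / 128000 * l * card A \<le> 1 / 128000 * (2 * p) * n"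
      using l_bounds p_pos by (intro mult_mono) auto
    also have "\<dots> = p * n / 32 * (1 / 2000)" by simp
    also have "\<dots> \<le> p * n / 32 * (p * real d)" using pd p_pos by (intro mult_left_mono) auto
    also have "\<dots> = p\<^sup>2 * n * d / 32" by (simp add: power2_eq_square)
    finally show "exp (1 / 128000 * l * card A) \<le> exp (p\<^sup>2 * n * d / 32)" by simp
  qed auto
  also have "\<dots> = exp (17 * real d + p\<^sup>2 * n * d / 32)" by (simp add: exp_add)
  \<comment> \<open>The gain splits as \<open>1 / 16 = 1 / 32 + 1 / 64 + 1 / 64\<close>: one
    \<open>1 / 64\<close> absorbs \<open>17 * d\<close>, the other is at least
    \<open>p * n / 128000\<close>. This exceeds \<open>3 * sqrt n\<close> because
    \<open>400000 \<ge> 3 * 128000\<close>, which is where the constant in the lower bound on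
    \<open>p\<close> comes from.\<close>
  also have "\<dots> \<le> exp (- 3 * sqrt n + p\<^sup>2 * n * d / 16)"
  proof -
    have "p * n * (1 / 2000) \<le> p * n * (p * real d)" using pd p_pos by (intro mult_left_mono) auto
    then have "p * n / 128000 \<le> p\<^sup>2 * n * d / 64" by (simp add: power2_eq_square mult_ac)
    then show ?thesis using x pn real_sqrt_ge_zero[of "real n"] by simp
  qed
  finally have loss: "real (card A choose d) * l ^ d \<le> exp (- 3 * sqrt n) * exp (p\<^sup>2 * n * d / 16)"
    by (simp only: exp_add)
  let ?F = "{G\<in>S. card (nbrs G A v) = d \<and> G \<in> bounded_degree k}"
  have "weight l ?F * exp (p\<^sup>2 * n * d / 16) \<le> weight l ?F * (1 + l\<^sup>2 / 2) ^ (d * q)"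
    using gain by (intro mult_left_mono weight_nonneg l_bounds)
  also have "\<dots> \<le> real (card A choose d) * l ^ d * weight l S"
    by (rule weight_full_defect_le[OF v l_bounds(3) small q(1)])
  also have "\<dots> \<le> exp (- 3 * sqrt n) * exp (p\<^sup>2 * n * d / 16) * weight l S"
    using loss by (intro mult_right_mono weight_nonneg l_bounds)
  finally have "weight l ?F * exp (p\<^sup>2 * n * d / 16) \<le> exp (- 3 * sqrt n) * weight l S * exp (p\<^sup>2 * n * d / 16)"
    by (simp add: mult_ac)
  then show ?thesis by simp
qed

text \<open>A typical vertex has order \<open>p * n\<close> cross neighbours, far more than
  \<open>d\<close> of order \<open>1 / p\<close>, since \<open>p\<^sup>2 * n\<close> is large. This
  will bound the overlap with the class in which \<open>a\<close> has changed sides; the factor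
  \<open>1 / 4\<close> is what \<open>weight_half\<close> asks for.\<close>

lemma weight_few_cross_neighbours_le_quarter:
  assumes a: "a \<in> A"
  shows "weight l {G\<in>S. card (nbrs G B a) \<le> d} \<le> 1 / 4 * weight l S"
proof -
  define q where "q = card B - 2 * d * k"
  have *: "real (2 * d * k) \<le> 3 / 20 * n" using dk by simp
  then have "real (2 * d * k) \<le> real (card B)" using cardB by linarith
  then have le: "2 * d * k \<le> card B" by (simp only: of_nat_le_iff)
  then have "real q = real (card B) - real (2 * d * k)" by (simp only: q_def of_nat_diff)
  then have q: "q + 2 * d * k \<le> card B" "n / 4 \<le> real q"
    using le * cardB unfolding q_def by linarith+
  have pd: "p * real d \<le> 1 / 1000"
    using d_upper p_pos by (simp add: field_simps)
  have small: "(1 + l) ^ d \<le> 2"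
  proof -
    have "real d * l \<le> real d * (2 * p)" using l_bounds by (intro mult_left_mono) auto
    also have "\<dots> = 2 * (p * real d)" by simp
    also have "\<dots> \<le> 1 / 2" using pd by linarith
    finally have "exp (real d * l) \<le> 2" by (rule exp_le_two)
    then show ?thesis using power_le_exp[of l d] l_bounds by linarith
  qed
  have "exp (p * n / 16) \<le> exp (real q * (l / 2 / 2))"
  proof -
    have "p * n / 16 = (n / 4) * (p / 4)" by simp
    also have "\<dots> \<le> real q * (l / 4)" using q l_bounds p_pos by (intro mult_mono) auto
    finally show ?thesis by simp
  qed
  also have "\<dots> \<le> (1 + l / 2) ^ q" using l_bounds p_upper by (intro exp_le_power) linarith+
  finally have gain: "exp (p * n / 16) \<le> (1 + l / 2) ^ q" .
  \<comment> \<open>With tilt \<open>1 / 64\<close> the exponential costs \<open>p * n / 32\<close>,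
    half of the gain. The power costs \<open>6 * d\<close> as \<open>64 = 2 ^ 6\<close>, negligible
    because \<open>1 / p\<close> is a tiny fraction of \<open>p * n\<close>.\<close>
  have "(\<Sum>j\<le>d. real (card B choose j) * l ^ j) \<le> (1 / (1 / 64)) ^ d * exp (1 / 64 * l * card B)"
    by (rule sum_choose_power_le) (use l_bounds in auto)
  also have "\<dots> \<le> exp (real 6 * real d) * exp (p * n / 32)"
  proof (intro mult_mono)
    show "(1 / (1 / 64)) ^ d \<le> exp (real 6 * real d)" by (rule power_two_le_exp) auto
    have "card B \<le> n" using n finA finB by (metis card_mono finite_Un sup_ge2)
    then have "1 / 64 * l * card B \<le> 1 / 64 * (2 * p) * n"
      using l_bounds p_pos by (intro mult_mono) auto
    then show "exp (1 / 64 * l * card B) \<le> exp (p * n / 32)" by simp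
  qed auto
  also have "\<dots> = exp (6 * real d + p * n / 32)" by (simp add: exp_add)
  also have "\<dots> \<le> exp (- sqrt n + p * n / 16)"
    using d_upper inverse_p pn real_sqrt_ge_zero[of "real n"] by simp
  finally have loss: "(\<Sum>j\<le>d. real (card B choose j) * l ^ j) \<le> exp (- sqrt n) * exp (p * n / 16)"
    by (simp only: exp_add)
  let ?F = "{G\<in>S. card (nbrs G B a) \<le> d \<and> G \<in> bounded_degree k}"
  have "weight l ?F * exp (p * n / 16) \<le> weight l ?F * (1 + l / 2) ^ q"
    using gain by (intro mult_left_mono weight_nonneg l_bounds)
  also have "\<dots> \<le> (\<Sum>j\<le>d. real (card B choose j) * l ^ j) * weight l S"
    by (rule weight_few_cross_neighbours_le[OF a l_bounds(3) small q(1)])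
  also have "\<dots> \<le> exp (- sqrt n) * exp (p * n / 16) * weight l S"
    using loss by (intro mult_right_mono weight_nonneg l_bounds)
  finally have "weight l ?F * exp (p * n / 16) \<le> exp (- sqrt n) * weight l S * exp (p * n / 16)"
    by (simp add: mult_ac)
  then have F: "weight l ?F \<le> exp (- sqrt n) * weight l S" by simp
  have "weight l {G\<in>S. card (nbrs G B a) \<le> d} \<le> weight l (?F \<union> (S - bounded_degree k))"
    using finite_near_bipartite l_bounds(3) by (intro weight_mono) auto
  also have "\<dots> \<le> weight l ?F + weight l (S - bounded_degree k)"
    using finite_near_bipartite l_bounds(3) by (intro weight_Un_le) auto
  also have "\<dots> \<le> exp (- sqrt n) * weight l S + n * exp (- (14 * p * n)) * weight l S"
    by (intro add_mono F weight_unbounded_degree_le)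
  also have "\<dots> = (exp (- sqrt n) + n * exp (- (14 * p * n))) * weight l S"
    by (simp add: algebra_simps)
  also have "\<dots> \<le> 1 / 4 * weight l S"
  proof (intro mult_right_mono weight_nonneg l_bounds)
    have "n * exp (- (14 * p * n)) \<le> n * exp (- 3 * sqrt n)"
      using exp_pn by (intro mult_left_mono) auto
    moreover have "8 \<le> exp (sqrt n)"
      using exp_ge_add_one_self[of "sqrt n"] sqrt_n by linarith
    then have "exp (- sqrt n) \<le> 1 / 8" by (simp add: exp_minus field_simps)
    ultimately show "exp (- sqrt n) + n * exp (- (14 * p * n)) \<le> 1 / 4" using exp_sqrt by linarith
  qed
  finally show ?thesis .
qed

end

lemma sparse_bipartition_commute:
  "sparse_bipartition A B d n p \<Longrightarrow> sparse_bipartition B A d n p"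
  unfolding sparse_bipartition_def bipartition_def sparse_bipartition_axioms_def
  by (simp add: Int_commute Un_commute)

context sparse_bipartition
begin

text \<open>One inserted edge raises a degree by at most one, so a graph about to leave
  \<open>S\<close> has a vertex with exactly \<open>d\<close> neighbours on its own side. Sum over
  the vertices of \<open>A\<close>, over those of \<open>B\<close> via the mirrored locale, and add
  the graphs violating the degree cap.\<close>

lemma weight_boundary_le:
  assumes V: "T \<subseteq> {G. G \<subseteq> nsets (A \<union> B) 2 \<and> triangle_free G}"
  shows "weight l {G\<in>S. \<exists>e. insert e G \<in> T \<and> insert e G \<notin> S} \<le> exp (- sqrt n) * weight l S"
proof -
  interpret BA: sparse_bipartition B A d n p
    by (rule sparse_bipartition_commute) (rule sparse_bipartition_axioms)
  have bb: "BA.bounded_degree k = bounded_degree k"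
    by (simp add: BA.bounded_degree_def bounded_degree_def Un_commute)
  let ?E = "\<lambda>X v. {G\<in>S. card (nbrs G X v) = d \<and> G \<in> bounded_degree k}"
  let ?Bd = "{G\<in>S. \<exists>e. insert e G \<in> T \<and> insert e G \<notin> S}"
  have step: "card (nbrs (insert e G) X v) \<le> card (nbrs G X v) + 1"
    if X: "finite X" and e: "e \<in> nsets (A \<union> B) 2" for e G X v
  proof -
    obtain x y where xy: "e = {x, y}" "x \<noteq> y" using e by (rule nsets2_E)
    have "nbrs (insert e G) X v \<subseteq> insert (if v = x then y else x) (nbrs G X v)"
      using xy by (auto simp: nbrs_def doubleton_eq_iff)
    then have "card (nbrs (insert e G) X v) \<le> card (insert (if v = x then y else x) (nbrs G X v))"
      using X by (intro card_mono) (auto simp: finite_nbrs)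
    also have "\<dots> \<le> card (nbrs G X v) + 1"
      using X by (simp add: card_insert_if finite_nbrs)
    finally show ?thesis .
  qed
  have "?Bd \<subseteq> (\<Union>v\<in>A. ?E A v) \<union> (\<Union>v\<in>B. ?E B v) \<union> (S - bounded_degree k)"
  proof
    fix G assume "G \<in> ?Bd"
    then obtain e where G: "G \<in> S" and e: "insert e G \<in> T" "insert e G \<notin> S" by blast
    have eE: "e \<in> nsets (A \<union> B) 2" using e(1) V by auto
    from e V consider v where "v \<in> A" "d < card (nbrs (insert e G) A v)" 
      | v where "v \<in> B" "d < card (nbrs (insert e G) B v)"
      by (fastforce simp: near_bipartite_def not_le)
    then have "(\<exists>v\<in>A. card (nbrs G A v) = d) \<or> (\<exists>v\<in>B. card (nbrs G B v) = d)"
    proof cases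
      case (1 v)
      have "card (nbrs G A v) \<le> d" using G 1(1) by (simp add: near_bipartite_def)
      then show ?thesis using 1 step[OF finA eE, of G v] by (intro disjI1 bexI[of _ v]) auto
    next
      case (2 v)
      have "card (nbrs G B v) \<le> d" using G 2(1) by (simp add: near_bipartite_def)
      then show ?thesis using 2 step[OF finB eE, of G v] by (intro disjI2 bexI[of _ v]) auto
    qed
    then show "G \<in> (\<Union>v\<in>A. ?E A v) \<union> (\<Union>v\<in>B. ?E B v) \<union> (S - bounded_degree k)" using G by blast
  qed
  then have "weight l ?Bd \<le> weight l ((\<Union>v\<in>A. ?E A v) \<union> (\<Union>v\<in>B. ?E B v) \<union> (S - bounded_degree k))"
    using finA finB finite_near_bipartite l_bounds(3) by (intro weight_mono) auto
  also have "\<dots> \<le> weight l ((\<Union>v\<in>A. ?E A v) \<union> (\<Union>v\<in>B. ?E B v)) + weight l (S - bounded_degree k)"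
    using finA finB finite_near_bipartite l_bounds(3) by (intro weight_Un_le) auto
  also have "weight l ((\<Union>v\<in>A. ?E A v) \<union> (\<Union>v\<in>B. ?E B v)) \<le> weight l (\<Union>v\<in>A. ?E A v) + weight l (\<Union>v\<in>B. ?E B v)"
    using finA finB finite_near_bipartite l_bounds(3) by (intro weight_Un_le) auto
  also have "weight l (\<Union>v\<in>A. ?E A v) \<le> (\<Sum>v\<in>A. weight l (?E A v))"
    using finA finite_near_bipartite l_bounds(3) by (intro weight_UN_le) auto
  also have "\<dots> \<le> (\<Sum>v\<in>A. exp (- 3 * sqrt n) * weight l S)"
    by (intro sum_mono weight_full_defect_le_exp)
  also have "weight l (\<Union>v\<in>B. ?E B v) \<le> (\<Sum>v\<in>B. weight l (?E B v))"
    using finB finite_near_bipartite l_bounds(3) by (intro weight_UN_le) auto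
  also have "\<dots> \<le> (\<Sum>v\<in>B. exp (- 3 * sqrt n) * weight l S)"
    using BA.weight_full_defect_le_exp
    unfolding bb near_bipartite_commute[of B A] by (intro sum_mono)
  also have "weight l (S - bounded_degree k) \<le> n * exp (- 3 * sqrt n) * weight l S"
  proof -
    have "n * exp (- (14 * p * n)) \<le> n * exp (- 3 * sqrt n)"
      using exp_pn by (intro mult_left_mono) auto
    then have "n * exp (- (14 * p * n)) * weight l S \<le> n * exp (- 3 * sqrt n) * weight l S"
      by (intro mult_right_mono weight_nonneg l_bounds)
    then show ?thesis using weight_unbounded_degree_le by linarith
  qed
  finally have "weight l ?Bd \<le> (real (card A) + real (card B) + n) * (exp (- 3 * sqrt n) * weight l S)"
    by (simp add: algebra_simps)
  also have "real (card A) + real (card B) = n"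
    using n card_Un_disjoint[OF finA finB disj] by simp
  also have "(real n + real n) * (exp (- 3 * sqrt n) * weight l S) = 2 * real n * exp (- 3 * sqrt n) * weight l S"
    by simp
  also have "\<dots> \<le> exp (- sqrt n) * weight l S"
    by (intro mult_right_mono exp_sqrt weight_nonneg l_bounds)
  finally show ?thesis .
qed

end

section \<open>Dense edge probabilities\<close>

definition cross :: "'a set \<Rightarrow> 'a set \<Rightarrow> 'a set set" where
  "cross A B = (\<lambda>(a, b). {a, b}) ` (A \<times> B)"

definition defects :: "'a set \<Rightarrow> 'a set \<Rightarrow> 'a set set \<Rightarrow> 'a set set" where
  "defects A B G = {e\<in>G. e \<subseteq> A \<or> e \<subseteq> B}"

lemma defects_commute: "defects A B G = defects B A G"
  by (auto simp: defects_def)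

lemma mem_cross: "{x, y} \<in> cross A B \<longleftrightarrow> x \<in> A \<and> y \<in> B \<or> x \<in> B \<and> y \<in> A"
  by (force simp: cross_def doubleton_eq_iff image_iff)

lemma crossE: "e \<in> cross A B \<Longrightarrow> (\<And>a b. a \<in> A \<Longrightarrow> b \<in> B \<Longrightarrow> e = {a, b} \<Longrightarrow> thesis) \<Longrightarrow> thesis"
  by (auto simp: cross_def)

lemma card_cross: "A \<inter> B = {} \<Longrightarrow> card (cross A B) = card A * card B"
  unfolding cross_def card_cartesian_product[symmetric]
  by (rule card_image) (auto simp: inj_on_def doubleton_eq_iff)

lemma finite_cross: "finite A \<Longrightarrow> finite B \<Longrightarrow> finite (cross A B)"
  by (simp add: cross_def)

lemma weight_Pow: "finite C \<Longrightarrow> weight l (Pow C) = (1 + l) ^ card C"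
  using prod_add[of C "\<lambda>_. l" "\<lambda>_. 1"] by (simp add: weight_def add.commute)

lemma triangle_free_cross: "A \<inter> B = {} \<Longrightarrow> triangle_free (cross A B)"
  unfolding triangle_free_def mem_cross by blast

lemma defect_free_eq_Pow_cross:
  assumes AB: "A \<inter> B = {}" "A \<union> B = {1..n}"
  shows "{G\<in>triangle_free_graphs n. defects A B G = {}} = Pow (cross A B)"
proof (intro equalityI subsetI)
  fix G assume G: "G \<in> {G\<in>triangle_free_graphs n. defects A B G = {}}"
  have "e \<in> cross A B" if e: "e \<in> G" for e
  proof -
    have "e \<in> nsets (A \<union> B) 2" using e G AB by (auto simp: triangle_free_graphs_def)
    then obtain x y where "e = {x, y}" "x \<in> A \<union> B" "y \<in> A \<union> B" by (rule nsets2_E)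
    moreover have "\<not> e \<subseteq> A" "\<not> e \<subseteq> B" using e G by (auto simp: defects_def)
    ultimately show ?thesis using mem_cross[of x y A B] by auto
  qed
  then show "G \<in> Pow (cross A B)" by blast
next
  fix G assume "G \<in> Pow (cross A B)"
  then have G: "G \<subseteq> cross A B" by simp
  have "cross A B \<subseteq> nsets (A \<union> B) 2"
    using AB(1) by (auto elim!: crossE simp: doubleton_in_nsets_2)
  moreover have "triangle_free G" using triangle_free_mono[OF triangle_free_cross[OF AB(1)] G] .
  moreover have "\<not> e \<subseteq> A \<and> \<not> e \<subseteq> B" if "e \<in> cross A B" for e
    using that AB(1) by (auto elim!: crossE)
  then have "defects A B G = {}" using G by (auto simp: defects_def)
  ultimately show "G \<in> {G\<in>triangle_free_graphs n. defects A B G = {}}"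
    using G AB(2) by (auto simp: triangle_free_graphs_def)
qed

text \<open>The edge \<open>{u, v}\<close> makes the neighbourhoods of \<open>u\<close> and
  \<open>v\<close> in \<open>B\<close> disjoint. Each \<open>w\<close> in \<open>B\<close> is joined
  to \<open>u\<close>, to \<open>v\<close> or to neither, with total weight \<open>1 + 2 * l\<close>
  instead of the \<open>(1 + l)\<^sup>2\<close> of two free pairs; the other cross pairs are bounded
  as free.\<close>

lemma weight_one_defect_le:
  fixes l :: real
  assumes AB: "A \<inter> B = {}" "A \<union> B = {1..n}" and uv: "u \<in> A" "v \<in> A" "u \<noteq> v" and l: "0 \<le> l"
  shows "weight l {G\<in>triangle_free_graphs n. defects A B G = {{u, v}}}
    \<le> l * (1 + 2 * l) ^ card B * (1 + l) ^ ((card A - 2) * card B)"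
proof -
  have fin: "finite A" "finite B" using AB(2) by (metis finite_Un finite_atLeastAtMost)+
  let ?C = "cross (A - {u, v}) B"
  let ?f = "\<lambda>(H, X, Y). insert {u, v} (H \<union> (star u X \<union> star v Y))"
  let ?D = "Pow ?C \<times> Sigma (Pow B) (\<lambda>X. Pow (B - X))"
  have fC: "finite ?C" using fin by (simp add: finite_cross)
  have cC: "card ?C = (card A - 2) * card B"
  proof -
    have "card ?C = card (A - {u, v}) * card B" using AB(1) by (intro card_cross) auto
    also have "card (A - {u, v}) = card A - 2" using uv fin by (simp add: card_Diff_subset)
    finally show ?thesis .
  qed
  have sub: "{G\<in>triangle_free_graphs n. defects A B G = {{u, v}}} \<subseteq> ?f ` ?D"
  proof
    fix G assume G: "G \<in> {G\<in>triangle_free_graphs n. defects A B G = {{u, v}}}"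
    let ?H = "G \<inter> ?C" and ?X = "nbrs G B u" and ?Y = "nbrs G B v"
    have uvG: "{u, v} \<in> G" using G by (auto simp: defects_def)
    have "?Y \<subseteq> B - ?X"
    proof
      fix w assume w: "w \<in> ?Y"
      have "w \<notin> ?X"
      proof
        assume "w \<in> ?X"
        then have "{u, w} \<in> G" "{v, w} \<in> G" "w \<noteq> u" "w \<noteq> v" using w uv AB(1) by (auto simp: nbrs_def)
        moreover have "triangle_free G" using G by (simp add: triangle_free_graphs_def)
        ultimately show False using uvG uv(3) unfolding triangle_free_def by metis
      qed
      then show "w \<in> B - ?X" using w by (simp add: nbrs_def)
    qed
    then have dom: "(?H, ?X, ?Y) \<in> ?D" using nbrs_subset[of G B u] by blast
    have "G = ?f (?H, ?X, ?Y)"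
    proof (intro equalityI subsetI)
      fix e assume e: "e \<in> G"
      show "e \<in> ?f (?H, ?X, ?Y)"
      proof (cases "e \<subseteq> A \<or> e \<subseteq> B")
        case True
        then have "e \<in> defects A B G" using e by (simp add: defects_def)
        then show ?thesis using G by simp
      next
        case False
        have "e \<in> nsets (A \<union> B) 2" using e G AB by (auto simp: triangle_free_graphs_def)
        then obtain x y where xy: "e = {x, y}" "x \<in> A \<union> B" "y \<in> A \<union> B" by (rule nsets2_E)
        then have "x \<in> A \<and> y \<in> B \<or> x \<in> B \<and> y \<in> A" using False by auto
        then obtain a w where aw: "e = {a, w}" "a \<in> A" "w \<in> B"
          using xy(1) by (metis insert_commute)
        show ?thesis
        proof (cases "a = u \<or> a = v")
          case True
          then show ?thesis using aw e by (auto simp: nbrs_def mem_star)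
        next
          case False
          then have "e \<in> ?C" using aw by (auto simp: mem_cross)
          then show ?thesis using e by simp
        qed
      qed
    next
      fix e assume "e \<in> ?f (?H, ?X, ?Y)"
      then show "e \<in> G" using uvG by (auto simp: star_def nbrs_def)
    qed
    then show "G \<in> ?f ` ?D" using dom by blast
  qed
  have cardf: "card (?f (H, X, Y)) = 1 + (card H + (card X + card Y))" if "(H, X, Y) \<in> ?D" for H X Y
  proof -
    have *: "H \<subseteq> ?C" "X \<subseteq> B" "Y \<subseteq> B" using that by auto
    then have fin': "finite H" "finite X" "finite Y" using fC fin finite_subset by blast+
    have "star u X \<inter> star v Y = {}"
      using * uv AB(1) by (auto simp: star_def doubleton_eq_iff)
    then have 1: "card (star u X \<union> star v Y) = card X + card Y"
      using fin' by (simp add: card_Un_disjoint finite_star card_star)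
    have "{u, w} \<notin> ?C" "{v, w} \<notin> ?C" for w
      using uv AB(1) by (auto simp: mem_cross)
    then have "H \<inter> (star u X \<union> star v Y) = {}"
      using *(1) by (auto simp: star_def)
    then have 2: "card (H \<union> (star u X \<union> star v Y)) = card H + (card X + card Y)"
      using fin' 1 by (simp add: card_Un_disjoint finite_star)
    have "{u, v} \<notin> H \<union> (star u X \<union> star v Y)"
      using * uv AB(1) by (auto simp: mem_star mem_cross dest!: subsetD)
    then show ?thesis using 2 fin' by (simp add: finite_star)
  qed
  have "weight l {G\<in>triangle_free_graphs n. defects A B G = {{u, v}}} \<le> weight l (?f ` ?D)"
    using sub fC fin l by (intro weight_mono) auto
  also have "\<dots> \<le> (\<Sum>x\<in>?D. l ^ card (?f x))"
    unfolding weight_def using fC fin l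
    by (intro order_trans[OF sum_image_le]) (auto simp: o_def)
  also have "\<dots> = (\<Sum>(H, X, Y)\<in>?D. l * (l ^ card H * (l ^ card X * l ^ card Y)))"
    by (rule sum.cong[OF refl]) (use cardf in \<open>force simp: power_add\<close>)
  also have "\<dots> = (\<Sum>H\<in>Pow ?C. \<Sum>(X, Y)\<in>Sigma (Pow B) (\<lambda>X. Pow (B - X)). l * (l ^ card H * (l ^ card X * l ^ card Y)))"
    by (simp add: sum.cartesian_product)
  also have "\<dots> = (\<Sum>H\<in>Pow ?C. l * (l ^ card H * (\<Sum>(X, Y)\<in>Sigma (Pow B) (\<lambda>X. Pow (B - X)). l ^ card X * l ^ card Y)))"
    by (simp add: sum_distrib_left case_prod_unfold)
  also have "\<dots> = l * ((\<Sum>H\<in>Pow ?C. l ^ card H) * (\<Sum>(X, Y)\<in>Sigma (Pow B) (\<lambda>X. Pow (B - X)). l ^ card X * l ^ card Y))"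
    by (subst sum_distrib_right, subst sum_distrib_left, rule refl)
  also have "(\<Sum>H\<in>Pow ?C. l ^ card H) = (1 + l) ^ ((card A - 2) * card B)"
    using weight_Pow[OF fC, of l] by (simp add: weight_def cC)
  also have "(\<Sum>(X, Y)\<in>Sigma (Pow B) (\<lambda>X. Pow (B - X)). l ^ card X * l ^ card Y)
      = (\<Sum>X\<in>Pow B. \<Sum>Y\<in>Pow (B - X). l ^ card X * l ^ card Y)"
    using fin by (subst sum.Sigma) auto
  also have "\<dots> = (\<Sum>X\<in>Pow B. l ^ card X * (1 + l) ^ card (B - X))"
    unfolding sum_distrib_left[symmetric]
    using fin weight_Pow[where 'a = nat and l = l, unfolded weight_def] by (intro sum.cong refl) simp
  \<comment> \<open>The binomial theorem over subsets of \<open>B\<close>, with \<open>l\<close> for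
    elements of \<open>X\<close> and \<open>1 + l\<close> for the others.\<close>
  also have "\<dots> = (1 + 2 * l) ^ card B"
    using prod_add[OF fin(2), of "\<lambda>_. l" "\<lambda>_. 1 + l"] by (simp add: algebra_simps)
  finally show ?thesis by (simp add: mult_ac)
qed

text \<open>The identity \<open>1 + 2 * l = (1 - p\<^sup>2) * (1 + l)\<^sup>2\<close> expresses that
  a given \<open>w\<close> misses being a common neighbour with probability
  \<open>1 - p\<^sup>2\<close>. So one defect costs about \<open>(1 - p\<^sup>2) ^ card B\<close>
  compared with free cross edges.\<close>

lemma weight_one_defect_le_exp:
  assumes AB: "A \<inter> B = {}" "A \<union> B = {1..n}" and uv: "u \<in> A" "v \<in> A" "u \<noteq> v" and p: "0 < p" "p < 1"
    and b: "1 \<le> card B"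
  shows "weight (p / (1 - p)) {G\<in>triangle_free_graphs n. defects A B G = {{u, v}}}
    \<le> 2 * exp (- p\<^sup>2 * (real (card B) - 1)) * weight (p / (1 - p)) (Pow (cross A B))"
proof -
  define l where "l = p / (1 - p)"
  have l: "0 \<le> l" using p by (simp add: l_def)
  have fin: "finite A" "finite B" using AB(2) by (metis finite_Un finite_atLeastAtMost)+
  have "card {u, v} \<le> card A" using uv fin by (intro card_mono) auto
  then have a: "2 \<le> card A" using uv(3) by simp
  \<comment> \<open>One factor \<open>1 - p\<^sup>2\<close> is set aside to tame the weight
    \<open>l\<close> of the defect, which is unbounded as \<open>p\<close> tends to 1:
    \<open>l * (1 - p\<^sup>2) = p * (1 + p) \<le> 2\<close>. Hence \<open>card B - 1\<close> in the
    exponent.\<close>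
  obtain b' where b': "card B = Suc b'" using b by (cases "card B") auto
  have e1: "1 + 2 * l = (1 - p\<^sup>2) * (1 + l)\<^sup>2"
    using p by (simp add: l_def divide_simps) (simp add: power2_eq_square algebra_simps)
  have e2: "l * (1 - p\<^sup>2) = p * (1 + p)"
    using p by (simp add: l_def divide_simps) (simp add: power2_eq_square algebra_simps)
  have q: "0 \<le> 1 - p\<^sup>2" using p by (simp add: power_le_one)
  have "l * (1 + 2 * l) ^ card B = (l * (1 - p\<^sup>2)) * (1 - p\<^sup>2) ^ b' * (1 + l) ^ (2 * card B)"
    unfolding e1 power_mult_distrib power_mult b' by simp
  also have "\<dots> \<le> 2 * (1 - p\<^sup>2) ^ b' * (1 + l) ^ (2 * card B)"
  proof (intro mult_right_mono)
    have "p * (1 + p) \<le> 1 * 2" using p by (intro mult_mono) auto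
    then show "l * (1 - p\<^sup>2) \<le> 2" unfolding e2 by simp
  qed (use q l in auto)
  also have "\<dots> \<le> 2 * exp (- p\<^sup>2 * (real (card B) - 1)) * (1 + l) ^ (2 * card B)"
    using power_le_exp[of "- p\<^sup>2" b'] q l b' by (intro mult_right_mono mult_left_mono) (auto simp: mult.commute)
  finally have "l * (1 + 2 * l) ^ card B * (1 + l) ^ ((card A - 2) * card B)
      \<le> 2 * exp (- p\<^sup>2 * (real (card B) - 1)) * (1 + l) ^ (2 * card B) * (1 + l) ^ ((card A - 2) * card B)"
    using l by (intro mult_right_mono) auto
  also have "\<dots> = 2 * exp (- p\<^sup>2 * (real (card B) - 1)) * (1 + l) ^ (2 * card B + (card A - 2) * card B)"
    by (simp only: power_add mult.assoc)
  also have "2 * card B + (card A - 2) * card B = card A * card B"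
    using a by (metis add_mult_distrib le_add_diff_inverse)
  also have "(1 + l) ^ (card A * card B) = weight l (Pow (cross A B))"
    using AB(1) fin by (simp add: weight_Pow finite_cross card_cross)
  finally show ?thesis
    using weight_one_defect_le[OF AB uv l] unfolding l_def by (rule order_trans[rotated])
qed

text \<open>
  Applied to the neighbourhoods of two bipartitions that differ in one vertex; whichever of the
  two has weight at most \<open>5 / 8\<close> then serves as the bottleneck.
\<close>

lemma weight_half:
  assumes "finite \<Omega>" "S \<subseteq> \<Omega>" "S' \<subseteq> \<Omega>" "0 \<le> l" "weight l (S \<inter> S') \<le> 1 / 4 * weight l \<Omega>"
  shows "weight l S \<le> 5 / 8 * weight l \<Omega> \<or> weight l S' \<le> 5 / 8 * weight l \<Omega>"
proof -
  have "finite S" "finite S'" using assms finite_subset by blast+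
  then show ?thesis
    using weight_Un[of S S' l] weight_mono[of \<Omega> "S \<union> S'" l] assms by auto
qed

text \<open>The two bipartitions differ by vertex 1; \<open>2 / 5\<close> instead of
  \<open>1 / 2\<close> absorbs both the rounding and the moved vertex.\<close>

lemma card_halves:
  assumes n: "2000000000 \<le> sqrt n"
  defines "m \<equiv> n div 2"
  shows "1 \<in> {1..m}" "{1..m} \<inter> {m<..n} = {}" "{1..m} \<union> {m<..n} = {1..n}"
    "({1..m} - {1}) \<inter> insert 1 {m<..n} = {}" "({1..m} - {1}) \<union> insert 1 {m<..n} = {1..n}"
    "2 / 5 * real n \<le> card {1..m}" "2 / 5 * real n \<le> card {m<..n}"
    "2 / 5 * real n \<le> card ({1..m} - {1})" "2 / 5 * real n \<le> card (insert 1 {m<..n})"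
proof -
  have "2000000000 * 1 \<le> sqrt n * sqrt n" using n by (intro mult_mono) linarith+
  then have n': "2000000000 \<le> n" by simp
  then have m: "1 \<le> m" "m \<le> n" by (auto simp: m_def)
  then show "1 \<in> {1..m}" "{1..m} \<inter> {m<..n} = {}" "{1..m} \<union> {m<..n} = {1..n}"
    "({1..m} - {1}) \<inter> insert 1 {m<..n} = {}" "({1..m} - {1}) \<union> insert 1 {m<..n} = {1..n}" by auto
  have "real n \<le> 2 * real m + 1" unfolding m_def by linarith
  moreover have "2 * real m \<le> real n" unfolding m_def by linarith
  moreover have "card {1..m} = m" "card {m<..n} = n - m" "card ({1..m} - {1}) = m - 1"
    "card (insert 1 {m<..n}) = n - m + 1" using m by auto
  ultimately show "2 / 5 * real n \<le> card {1..m}" "2 / 5 * real n \<le> card {m<..n}"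
    "2 / 5 * real n \<le> card ({1..m} - {1})" "2 / 5 * real n \<le> card (insert 1 {m<..n})"
    using n' m by (auto simp: of_nat_diff)
qed

section \<open>The mixing time for sparse edge probabilities\<close>

lemma near_bipartite_subset: "A \<union> B = {1..n} \<Longrightarrow> near_bipartite A B d \<subseteq> triangle_free_graphs n"
  by (auto simp: near_bipartite_def triangle_free_graphs_def)

lemma sparse_mixing_time:
  assumes n: "2000000000 \<le> sqrt n" and p: "400000 \<le> p * sqrt n" "p \<le> 1 / 5000"
  shows "ereal (1 / 8 * exp (sqrt n)) \<le> ereal_of_enat (glauber_mixing_time n p)"
proof -
  \<comment> \<open>As \<open>1 / (1000 * p) \<ge> 2\<close>, rounding down loses at most a factor
    of two.\<close>
  define d where "d = nat \<lfloor>1 / (1000 * p)\<rfloor>"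
  have p0: "0 < p" using p(1) by (smt (verit) mult_nonpos_nonneg real_sqrt_ge_zero of_nat_0_le_iff)
  have "real (nat \<lfloor>x\<rfloor>) \<le> x" "x / 2 \<le> real (nat \<lfloor>x\<rfloor>)" if "2 \<le> x" for x :: real
    using that by linarith+
  moreover have "2 \<le> 1 / (1000 * p)" using p(2) p0 by (simp add: le_divide_eq)
  ultimately have "real d \<le> 1 / (1000 * p)" "1 / (1000 * p) / 2 \<le> real d"
    unfolding d_def by blast+
  then have d: "real d \<le> 1 / (1000 * p)" "1 / (2000 * p) \<le> real d" by simp_all
  let ?l = "p / (1 - p)" and ?T = "triangle_free_graphs n"
  have l: "0 \<le> ?l" using p(2) p0 by simp
  have "2000000000 * 1 \<le> sqrt n * sqrt n" using n by (intro mult_mono) linarith+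
  then have n2: "2 \<le> n" by simp
  have sparse: "sparse_bipartition A B d n p"
    if "A \<inter> B = {}" "A \<union> B = {1..n}" "2 / 5 * real n \<le> card A" "2 / 5 * real n \<le> card B" for A B :: "nat set"
  proof -
    have "finite A" "finite B" using that(2) by (metis finite_Un finite_atLeastAtMost)+
    then show ?thesis using that p d by unfold_locales auto
  qed
  have main: "ereal (1 / 8 * exp (sqrt n)) \<le> ereal_of_enat (glauber_mixing_time n p)"
    if sp: "sparse_bipartition A B d n p" and AB: "A \<union> B = {1..n}"
      and half: "weight ?l (near_bipartite A B d) \<le> 5 / 8 * weight ?l ?T" for A B
  proof -
    interpret sparse_bipartition A B d n p by (rule sp)
    have "ereal (1 / (8 * exp (- sqrt n))) \<le> ereal_of_enat (glauber_mixing_time n p)"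
    proof (rule glauber_mixing_time_bottleneck[OF n2 p0])
      show "near_bipartite A B d \<subseteq> ?T" by (rule near_bipartite_subset[OF AB])
      show "{} \<in> near_bipartite A B d"
        by (simp add: near_bipartite_def triangle_free_def nbrs_def)
      show "H \<in> near_bipartite A B d" if "G \<in> near_bipartite A B d" "H \<subseteq> G" for G H
        using that by (rule near_bipartite_mono)
      show "weight ?l (near_bipartite A B d) \<le> 5 / 8 * weight ?l ?T" by (rule half)
      show "weight ?l {G\<in>near_bipartite A B d. \<exists>e. insert e G \<in> ?T \<and> insert e G \<notin> near_bipartite A B d}
          \<le> exp (- sqrt n) * weight ?l (near_bipartite A B d)"
        using weight_boundary_le[of ?T] AB unfolding l_def by (simp add: triangle_free_graphs_def)
    qed (use p in auto)
    then show ?thesis by (simp add: exp_minus field_simps)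
  qed
  define m where "m = n div 2"
  let ?A = "{1..m}" and ?B = "{m<..n}"
  note h = card_halves[OF n, folded m_def]
  have sp: "sparse_bipartition ?A ?B d n p" and sp': "sparse_bipartition (?A - {1}) (insert 1 ?B) d n p"
    using h by (intro sparse; simp)+
  interpret sparse_bipartition ?A ?B d n p by (rule sp)
  let ?S = "near_bipartite ?A ?B d" and ?S' = "near_bipartite (?A - {1}) (insert 1 ?B) d"
  have SS: "?S \<subseteq> ?T" "?S' \<subseteq> ?T" by (rule near_bipartite_subset[OF h(3)], rule near_bipartite_subset[OF h(5)])
  \<comment> \<open>In the second bipartition vertex 1 sits with \<open>?B\<close>, so its former
    cross neighbours lie on its own side and number at most \<open>d\<close>.\<close>
  have "weight ?l (?S \<inter> ?S') \<le> weight ?l {G\<in>?S. card (nbrs G ?B 1) \<le> d}"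
  proof (rule weight_mono[OF _ _ l])
    show "?S \<inter> ?S' \<subseteq> {G\<in>?S. card (nbrs G ?B 1) \<le> d}"
    proof
      fix G assume G: "G \<in> ?S \<inter> ?S'"
      have "card (nbrs G ?B 1) \<le> card (nbrs G (insert 1 ?B) 1)"
        by (rule card_nbrs_mono) auto
      also have "\<dots> \<le> d" using G by (simp add: near_bipartite_def)
      finally show "G \<in> {G\<in>?S. card (nbrs G ?B 1) \<le> d}" using G by simp
    qed
  qed (use finite_near_bipartite in simp)
  also have "\<dots> \<le> 1 / 4 * weight ?l ?S"
    using weight_few_cross_neighbours_le_quarter[OF h(1)] unfolding l_def .
  also have "weight ?l ?S \<le> weight ?l ?T"
    using SS l by (intro weight_mono finite_triangle_free_graphs)
  finally have "weight ?l (?S \<inter> ?S') \<le> 1 / 4 * weight ?l ?T" by simp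
  from weight_half[OF finite_triangle_free_graphs SS l this] show ?thesis
    using main[OF sp h(3)] main[OF sp' h(5)] by blast
qed

section \<open>The mixing time for dense edge probabilities\<close>

lemma defects_insert_card: "finite G \<Longrightarrow> card (defects A B (insert e G)) \<le> card (defects A B G) + 1"
proof -
  assume G: "finite G"
  then have "finite (defects A B G)" by (simp add: defects_def)
  moreover have "defects A B (insert e G) \<subseteq> insert e (defects A B G)" by (auto simp: defects_def)
  ultimately have "card (defects A B (insert e G)) \<le> card (insert e (defects A B G))"
    by (intro card_mono) auto
  then show ?thesis using \<open>finite (defects A B G)\<close> by (simp add: card_insert_if split: if_splits)
qed

lemma cross_commute: "cross A B = cross B A"
  by (auto simp: cross_def insert_commute)

text \<open>A union bound over the pair that forms the defect: the at most \<open>n\<^sup>2\<close>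
  choices are outweighed by the exponentially small cost of each.\<close>

lemma dense_one_defect:
  assumes AB: "A \<inter> B = {}" "A \<union> B = {1..n}" and n: "2000000000 \<le> sqrt n" and p: "1 / 5000 \<le> p" "p < 1"
    and card: "2 / 5 * real n \<le> card A" "2 / 5 * real n \<le> card B"
  shows "weight (p / (1 - p)) {G\<in>triangle_free_graphs n. card (defects A B G) = 1}
    \<le> exp (- sqrt n) * weight (p / (1 - p)) (Pow (cross A B))"
proof -
  let ?l = "p / (1 - p)" and ?W = "weight (p / (1 - p)) (Pow (cross A B))"
  have l: "0 \<le> ?l" using p by simp
  have W: "0 \<le> ?W" using l by (rule weight_nonneg)
  have nn: "2000000000 * sqrt n \<le> n" using mult_right_mono[OF n, of "sqrt n"] by simp
  have fin: "finite A" "finite B" using AB(2) by (metis finite_Un finite_atLeastAtMost)+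
  let ?E = "nsets {1..n} 2" and ?F = "\<lambda>e. {G\<in>triangle_free_graphs n. defects A B G = {e}}"
  have fE: "finite ?E" by (simp add: finite_imp_finite_nsets)
  have fF: "finite (?F e)" for e using finite_triangle_free_graphs by simp
  have cover: "{G\<in>triangle_free_graphs n. card (defects A B G) = 1} \<subseteq> (\<Union>e\<in>?E. ?F e)"
  proof
    fix G assume G: "G \<in> {G\<in>triangle_free_graphs n. card (defects A B G) = 1}"
    then obtain e where e: "defects A B G = {e}" by (auto simp: card_Suc_eq One_nat_def)
    then have "e \<in> ?E" using G by (auto simp: defects_def triangle_free_graphs_def)
    then show "G \<in> (\<Union>e\<in>?E. ?F e)" using e G by auto
  qed
  \<comment> \<open>For \<open>p \<ge> 1 / 5000\<close> the exponent is at least a fixed multiple of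
    \<open>n\<close>; that multiple is tiny, but \<open>n \<ge> 2000000000 * sqrt n\<close>
    compensates.\<close>
  have exps: "exp (- p\<^sup>2 * (real b - 1)) \<le> exp (- 8 * sqrt n)" if "2 / 5 * real n \<le> real b" for b :: nat
  proof -
    have "(1 / 5000)\<^sup>2 \<le> p\<^sup>2" using p by (intro power_mono) auto
    then have "(1 / 5000)\<^sup>2 * (1 / 5 * real n) \<le> p\<^sup>2 * (real b - 1)"
      using that nn n by (intro mult_mono) auto
    then show ?thesis using nn by (simp add: power2_eq_square)
  qed
  have each: "weight ?l (?F e) \<le> 2 * exp (- 8 * sqrt n) * ?W" if e: "e \<in> ?E" for e
  proof -
    obtain u v where uv: "e = {u, v}" "u \<in> {1..n}" "v \<in> {1..n}" "u \<noteq> v" using e by (rule nsets2_E)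
    have b1: "1 \<le> card A" "1 \<le> card B" using card nn n by linarith+
    show ?thesis
    proof (cases "e \<subseteq> A \<or> e \<subseteq> B")
      case True
      then consider "u \<in> A" "v \<in> A" | "u \<in> B" "v \<in> B" using uv by auto
      then show ?thesis
      proof cases
        case 1
        have "weight ?l (?F e) \<le> 2 * exp (- p\<^sup>2 * (real (card B) - 1)) * ?W"
          unfolding uv(1) using p b1(2) uv(4) 1 AB by (intro weight_one_defect_le_exp) auto
        also have "\<dots> \<le> 2 * exp (- 8 * sqrt n) * ?W"
          using exps[OF card(2)] W by (intro mult_right_mono mult_left_mono) auto
        finally show ?thesis .
      next
        case 2
        have "weight ?l (?F e) \<le> 2 * exp (- p\<^sup>2 * (real (card A) - 1)) * ?W"
          unfolding uv(1) defects_commute[of A B] cross_commute[of A B]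
          using p b1(1) uv(4) 2 AB by (intro weight_one_defect_le_exp) (auto simp: Int_commute Un_commute)
        also have "\<dots> \<le> 2 * exp (- 8 * sqrt n) * ?W"
          using exps[OF card(1)] W by (intro mult_right_mono mult_left_mono) auto
        finally show ?thesis .
      qed
    next
      case False
      then have "?F e = {}" by (auto simp: defects_def)
      then have "weight ?l (?F e) = 0" by (simp only: weight_def sum.empty)
      then show ?thesis using W by simp
    qed
  qed
  have "weight ?l {G\<in>triangle_free_graphs n. card (defects A B G) = 1} \<le> weight ?l (\<Union>e\<in>?E. ?F e)"
    using cover fE fF l by (intro weight_mono) auto
  also have "\<dots> \<le> (\<Sum>e\<in>?E. weight ?l (?F e))"
    using fE fF l by (intro weight_UN_le)
  also have "\<dots> \<le> (\<Sum>e\<in>?E. 2 * exp (- 8 * sqrt n) * ?W)"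
    by (intro sum_mono each)
  also have "\<dots> = real (n choose 2) * (2 * exp (- 8 * sqrt n) * ?W)"
    by (simp add: card_nsets)
  also have "\<dots> \<le> (real n)\<^sup>2 * (2 * exp (- 8 * sqrt n) * ?W)"
  proof (intro mult_right_mono)
    have "real (n choose 2) \<le> real (n ^ 2)"
    proof (cases "2 \<le> n")
      case True
      then show ?thesis using binomial_le_pow[of 2 n] by (simp only: of_nat_le_iff)
    qed (simp add: binomial_eq_0)
    then show "real (n choose 2) \<le> (real n)\<^sup>2" by simp
  qed (use W in auto)
  also have "\<dots> \<le> exp (- sqrt n) * ?W"
  proof -
    have "(2 * real n)\<^sup>2 \<le> (exp (2 * sqrt n))\<^sup>2"
      by (intro power_mono double_le_exp_sqrt) auto
    also have "\<dots> = exp (4 * sqrt n)" by (simp add: exp_double[symmetric])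
    finally have "4 * (real n)\<^sup>2 \<le> exp (4 * sqrt n)" by (simp add: power_mult_distrib)
    then have "2 * (real n)\<^sup>2 \<le> exp (4 * sqrt n)" using zero_le_power2[of "real n"] by linarith
    then have "2 * (real n)\<^sup>2 * exp (- 8 * sqrt n) \<le> exp (4 * sqrt n) * exp (- 8 * sqrt n)"
      by (intro mult_right_mono) auto
    also have "\<dots> = exp (- 4 * sqrt n)" by (simp add: exp_add[symmetric])
    also have "\<dots> \<le> exp (- sqrt n)" by simp
    finally have "2 * (real n)\<^sup>2 * exp (- 8 * sqrt n) * ?W \<le> exp (- sqrt n) * ?W"
      using W by (intro mult_right_mono)
    then show ?thesis by (simp add: mult_ac)
  qed
  finally show ?thesis .
qed

text \<open>An insertion creates at most one defect, so graphs with at most one defect are left only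
  from graphs with exactly one. Those weigh little against the bipartite graphs, which already lie
  in the set.\<close>

lemma dense_mixing_time:
  assumes n: "2000000000 \<le> sqrt n" and p: "1 / 5000 \<le> p" "p < 1"
  shows "ereal (1 / 8 * exp (sqrt n)) \<le> ereal_of_enat (glauber_mixing_time n p)"
proof -
  let ?l = "p / (1 - p)" and ?T = "triangle_free_graphs n"
  have l: "0 \<le> ?l" and p0: "0 < p" using p by simp_all
  have nn: "2000000000 * sqrt n \<le> n" using mult_right_mono[OF n, of "sqrt n"] by simp
  then have n2: "2 \<le> n" using n by linarith
  define S where "S A B = {G\<in>?T. card (defects A B G) \<le> 1}" for A B
  define D where "D A B = {G\<in>?T. card (defects A B G) = 1}" for A B
  have finG: "finite G" if "G \<in> ?T" for G
    using that finite_subset[of G "nsets {1..n} 2"] by (auto simp: triangle_free_graphs_def finite_imp_finite_nsets)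
  have ST: "S A B \<subseteq> ?T" for A B by (auto simp: S_def)
  have finS: "finite (S A B)" for A B using finite_subset[OF ST finite_triangle_free_graphs] .
  have split: "S A B \<subseteq> Pow (cross A B) \<union> D A B" "Pow (cross A B) \<subseteq> S A B" "Pow (cross A B) \<subseteq> ?T"
    if "A \<inter> B = {}" "A \<union> B = {1..n}" for A B
  proof -
    show "S A B \<subseteq> Pow (cross A B) \<union> D A B"
    proof
      fix G assume G: "G \<in> S A B"
      then have "finite (defects A B G)" using finG by (auto simp: S_def defects_def)
      then have "card (defects A B G) = 1 \<or> defects A B G = {}" using G
        by (auto simp: S_def le_Suc_eq)
      then show "G \<in> Pow (cross A B) \<union> D A B"
        unfolding defect_free_eq_Pow_cross[OF that, symmetric] using G by (auto simp: S_def D_def)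
    qed
    show "Pow (cross A B) \<subseteq> S A B" "Pow (cross A B) \<subseteq> ?T"
      unfolding defect_free_eq_Pow_cross[OF that, symmetric] by (auto simp: S_def)
  qed
  have main: "ereal (1 / 8 * exp (sqrt n)) \<le> ereal_of_enat (glauber_mixing_time n p)"
    if AB: "A \<inter> B = {}" "A \<union> B = {1..n}" and card: "2 / 5 * real n \<le> card A" "2 / 5 * real n \<le> card B"
      and half: "weight ?l (S A B) \<le> 5 / 8 * weight ?l ?T" for A B
  proof -
    have "ereal (1 / (8 * exp (- sqrt n))) \<le> ereal_of_enat (glauber_mixing_time n p)"
    proof (rule glauber_mixing_time_bottleneck[OF n2 p0 p(2)])
      show "S A B \<subseteq> ?T" by (rule ST)
      show "{} \<in> S A B" using split(2)[OF AB] by blast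
      show "H \<in> S A B" if "G \<in> S A B" "H \<subseteq> G" for G H
      proof -
        have "card (defects A B H) \<le> card (defects A B G)"
          using that finG by (intro card_mono) (auto simp: S_def defects_def)
        then show ?thesis
          using that triangle_free_mono[of G H] by (auto simp: S_def triangle_free_graphs_def)
      qed
      show "weight ?l (S A B) \<le> 5 / 8 * weight ?l ?T" by (rule half)
      show "D A B \<subseteq> S A B" by (auto simp: S_def D_def)
      show "G \<in> D A B" if "G \<in> S A B" "insert e G \<in> ?T" "insert e G \<notin> S A B" for G e
        using that defects_insert_card[of G A B e] finG[of G] by (auto simp: S_def D_def)
      have "weight ?l (D A B) \<le> exp (- sqrt n) * weight ?l (Pow (cross A B))"
        unfolding D_def by (rule dense_one_defect[OF AB n p card])
      also have "\<dots> \<le> exp (- sqrt n) * weight ?l (S A B)"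
        using split(2)[OF AB] finS l by (intro mult_left_mono weight_mono) auto
      finally show "weight ?l (D A B) \<le> exp (- sqrt n) * weight ?l (S A B)" .
    qed simp
    then show ?thesis by (simp add: exp_minus field_simps)
  qed
  define m where "m = n div 2"
  define A where "A = {1..m}"
  define B where "B = {m<..n}"
  note h = card_halves[OF n, folded m_def, folded A_def B_def]
  have fin: "finite A" "finite B" by (simp_all add: A_def B_def)
  let ?A' = "A - {1}" and ?B' = "insert 1 B"
  have small: "exp (- sqrt n) \<le> 1 / 16"
  proof -
    have "16 \<le> exp (sqrt n)" using exp_ge_add_one_self[of "sqrt n"] n by linarith
    then show ?thesis by (simp add: exp_minus field_simps)
  qed
  have D_small: "weight ?l (D X Y) \<le> 1 / 16 * weight ?l ?T"
    if XY: "X \<inter> Y = {}" "X \<union> Y = {1..n}" "2 / 5 * real n \<le> card X" "2 / 5 * real n \<le> card Y" for X Y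
  proof -
    have "weight ?l (D X Y) \<le> exp (- sqrt n) * weight ?l (Pow (cross X Y))"
      unfolding D_def by (rule dense_one_defect[OF XY(1,2) n p XY(3,4)])
    also have "\<dots> \<le> 1 / 16 * weight ?l ?T"
      using small split(3)[OF XY(1,2)] l
      by (intro mult_mono weight_mono finite_triangle_free_graphs weight_nonneg) auto
    finally show ?thesis .
  qed
  \<comment> \<open>Graphs that are bipartite for both splittings have no edge at vertex 1: an edge
    to \<open>B\<close> lies inside a part of the second splitting, one to \<open>?A'\<close> inside
    a part of the first. Losing these \<open>card B\<close> free pairs costs a factor
    \<open>(1 + ?l) ^ card B\<close>, at least 16 by Bernoulli.\<close>
  have C_small: "weight ?l (Pow (cross ?A' B)) \<le> 1 / 16 * weight ?l ?T"
  proof -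
    have "card A = card ?A' + 1" using h(1) fin by (metis card_Suc_Diff1 Suc_eq_plus1)
    then have "weight ?l (Pow (cross A B)) = (1 + ?l) ^ card B * weight ?l (Pow (cross ?A' B))"
      using fin h(2) by (subst (1 2) weight_Pow) (auto simp: finite_cross card_cross power_add[symmetric] Diff_Int_distrib2 add.commute)
    moreover have "16 \<le> (1 + ?l) ^ card B"
    proof -
      have "16 \<le> 1 + (1 / 5000) * real (card B)" using h(7) nn n by linarith
      also have "(1 / 5000) * real (card B) \<le> ?l * real (card B)"
      proof (intro mult_right_mono)
        have "p * (1 - p) \<le> p * 1" using p by (intro mult_left_mono) auto
        then show "1 / 5000 \<le> ?l" using p by (intro order_trans[OF p(1)]) (simp add: le_divide_eq)
      qed simp
      also have "1 + ?l * real (card B) \<le> (1 + ?l) ^ card B"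
        using Bernoulli_inequality[of ?l "card B"] l by (simp add: mult.commute)
      finally show ?thesis by simp
    qed
    ultimately have "16 * weight ?l (Pow (cross ?A' B)) \<le> weight ?l (Pow (cross A B))"
      using l by (auto intro!: mult_right_mono weight_nonneg)
    also have "\<dots> \<le> weight ?l ?T"
      using split(3)[OF h(2,3)] l by (intro weight_mono finite_triangle_free_graphs)
    finally show ?thesis by simp
  qed
  have "S A B \<inter> S ?A' ?B' \<subseteq> D A B \<union> (D ?A' ?B' \<union> Pow (cross ?A' B))"
  proof
    fix G assume G: "G \<in> S A B \<inter> S ?A' ?B'"
    have "e \<in> cross ?A' B" if e: "e \<in> cross A B" "e \<in> cross ?A' ?B'" for e
    proof -
      obtain a b where ab: "a \<in> A" "b \<in> B" "e = {a, b}" using e(1) by (rule crossE)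
      then show ?thesis using e(2) h(2) by (auto simp: mem_cross)
    qed
    then show "G \<in> D A B \<union> (D ?A' ?B' \<union> Pow (cross ?A' B))"
      using G split(1)[OF h(2,3)] split(1)[OF h(4,5)] by blast
  qed
  then have "weight ?l (S A B \<inter> S ?A' ?B') \<le> weight ?l (D A B \<union> (D ?A' ?B' \<union> Pow (cross ?A' B)))"
    using l fin finite_triangle_free_graphs by (intro weight_mono) (auto simp: D_def finite_cross)
  also have "\<dots> \<le> weight ?l (D A B) + weight ?l (D ?A' ?B' \<union> Pow (cross ?A' B))"
    using l fin finite_triangle_free_graphs by (intro weight_Un_le) (auto simp: D_def finite_cross)
  also have "weight ?l (D ?A' ?B' \<union> Pow (cross ?A' B)) \<le> weight ?l (D ?A' ?B') + weight ?l (Pow (cross ?A' B))"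
    using l fin finite_triangle_free_graphs by (intro weight_Un_le) (auto simp: D_def finite_cross)
  \<comment> \<open>Three pieces of at most \<open>1 / 16\<close> each.\<close>
  finally have "weight ?l (S A B \<inter> S ?A' ?B') \<le> 1 / 4 * weight ?l ?T"
    using D_small[OF h(2,3,6,7)] D_small[OF h(4,5,8,9)] C_small weight_nonneg[OF l, of ?T] by linarith
  from weight_half[OF finite_triangle_free_graphs ST ST l this] show ?thesis
    using main[OF h(2,3,6,7)] main[OF h(4,5,8,9)] by blast
qed

theorem theorem1p2:
  shows "\<exists>C>0. \<exists>c>0. \<exists>n0::nat. \<forall>n\<ge>n0. \<forall>p::real.
           C * real n powr (- 1 / 2) \<le> p \<and> p < 1 \<longrightarrow>
           ereal (c * exp (sqrt (real n))) \<le> ereal_of_enat (glauber_mixing_time n p)"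
proof (intro exI conjI allI impI)
  fix n :: nat and p :: real
  \<comment> \<open>The threshold is the square of \<open>2000000000\<close>, the value of
    \<open>sqrt n\<close> from which both ranges of \<open>p\<close> are covered; they meet at
    \<open>p = 1 / 5000\<close>. The witness \<open>c = 1 / 8\<close> comes from the bottleneck
    bound.\<close>
  assume n: "4000000000000000000 \<le> n" and p: "400000 * real n powr (- 1 / 2) \<le> p \<and> p < 1"
  have "sqrt (2000000000\<^sup>2) \<le> sqrt n" using n by (intro real_sqrt_le_mono) simp
  then have n': "2000000000 \<le> sqrt n" by simp
  have "real n powr (- 1 / 2) * sqrt n = 1"
    using n by (simp add: powr_half_sqrt[symmetric] powr_add[symmetric])
  then have "400000 \<le> p * sqrt n"
    using mult_right_mono[OF conjunct1[OF p], of "sqrt n"] by simp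
  then show "ereal (1 / 8 * exp (sqrt n)) \<le> ereal_of_enat (glauber_mixing_time n p)"
    using sparse_mixing_time[OF n', of p] dense_mixing_time[OF n', of p] p by linarith
qed auto

end
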